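(* Let $D_0$ be an oriented marked graph diagram. (i) If $D$ is obtained from $D_0$ by the move $\Gamma_6$ (replacing an arc of $D_0$ by a marked curl of type $\Gamma_6$), then $\ll D\gg=\big((a^{-6}+1+a^6)x+y\big)\ll D_0\gg$. (ii) If $D$ is obtained from $D_0$ by the move $\Gamma_6'$ (replacing an arc of $D_0$ by a marked curl of type $\Gamma_6'$), then $\ll D\gg=\big(x+(a^{-6}+1+a^6)y\big)\ll D_0\gg$.
   Context: Marked graph diagrams. An oriented marked graph diagram is a planar oriented link diagram possibly with finitely many rigid 4-valent marked vertices. Near each marked vertex there are coordinates $(u,v)\in[-1,1]^2$ in which the diagram is $\{u^2=v^2\}$ and the marker is the interval $\{v=0\}$; the four edge ends are called NE, NW, SW, SE according to the signs of $(u,v)$. Every edge is oriented so that at each marked vertex one opposite pair of ends points towards the vertex and the other opposite pair points away. The positive resolution of a marked vertex replaces it by two disjoint arcs joining NW with NE and SW with SE (the two regions containing the ends of the marker get merged); the negative resolution joins NW with SW and NE with SE. Marked curls. A marked curl is a small piece of diagram with two boundary ends, consisting of one marked vertex $p$, a loop joining two neighbouring edge ends at $p$ and bounding a disk whose interior is disjoint from the diagram, and the other two edge ends at $p$ running to the two boundary ends. It is of type $\Gamma_6$ if no end of the marker lies in the disk bounded by the loop (so the positive resolution gives an arc together with a disjoint circle and the negative resolution gives a single arc). It is of type $\Gamma_6'$ if one end of the marker lies in the disk bounded by the loop (so the positive resolution gives a single arc and the negative resolution gives an arc together with a disjoint circle). The moves $\Gamma_6$, $\Gamma_6'$ replace an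 oriented arc by a marked curl of the respective type with compatible orientation. $A_2$ bracket. A tangled trivalent graph diagram is an oriented link diagram in $S^2$ possibly with some trivalent vertices, each of whose three incident edges are all oriented inward (sink) or all outward (source). Let $O$ be the crossingless diagram of the trivial knot. Kuperberg's $A_2$ bracket $\langle\cdot\rangle_{A_2}\in\mathbb Z[a^{-1},a]$ is the regular isotopy invariant of (non-empty) tangled trivalent graph diagrams determined by: (K0) $\langle O\rangle_{A_2}=1$; (K1) $\langle D\sqcup O\rangle_{A_2}=(a^{-6}+1+a^6)\langle D\rangle_{A_2}$; (K2) a bigon face with its two outer legs, replaced by a single edge, contributes the factor $a^{-3}+a^{3}$; (K3) a diagram with a square face (four trivalent vertices, alternately sources and sinks, each with one outer leg) equals the sum of the two diagrams obtained by deleting the square and joining the four legs in pairs of neighbouring legs in the two planar ways; (K4) for a positive crossing, $\langle D_+\rangle_{A_2}=-a\langle D_H\rangle_{A_2}+a^{-2}\langle D_{sm}\rangle_{A_2}$; (K5) for a negative crossing, $\langle D_-\rangle_{A_2}=-a^{-1}\langle D_H\rangle_{A_2}+a^{2}\langle D_{sm}\rangle_{A_2}$, where $D_{sm}$ is the oriented smoothing and $D_H$ is obtained by letting the two incoming strands end at a sink, the two outgoing strands start at a source, and adding an edge from the source to the sink. Polynomial. For an oriented marked graph diagram $D$, $[[D]]\in\mathbb Z[a^{-1},a,x,y]$ is defined by $[[D]]=\langle D\rangle_{A_2}$ if $D$ has no marked vertices, and, for each marked vertex, $[[D]]=x[[D']]+y[[D'']]$ where $D'$, $D''$ are obtained by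 positive, respectively negative, resolution of that vertex. The writhe $w(D)$ is the sum of the signs of all crossings of $D$, and $\ll D\gg:=a^{8w(D)}[[D]]$. *)

theory Defs
  imports Main "HOL-Library.Multiset" "HOL-Library.Poly_Mapping"
    "HOL-Computational_Algebra.Polynomial"
begin

section \<open>Diagrams on the oriented sphere\<close>

text \<open>
  Diagrams are encoded by oriented planar diagram codes. Edges are numbered. The dart
  \<open>(e, True)\<close> is the end of \<open>e\<close> at which \<open>e\<close> leaves a vertex, \<open>(e, False)\<close> is the end at
  which \<open>e\<close> arrives at a vertex. A vertex is the list of its darts in counterclockwise order:

  \<^item> \<open>Point p q\<close>: an ordinary point in the interior of an arc. It carries no meaning (see
    \<open>isotopic\<close> below) but allows circles without crossings, and gives names to arcs;
  \<^item> \<open>Trivalent p q r\<close>: a sink or a source;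
  \<^item> \<open>Crossing p q r s\<close>: \<open>p\<close>, \<open>r\<close> belong to the lower strand and \<open>q\<close>, \<open>s\<close> to the upper strand;
  \<^item> \<open>Marked ne nw sw se\<close>: a marked vertex. The ends of the marker lie in the two corners
    between \<open>nw\<close> and \<open>sw\<close> and between \<open>se\<close> and \<open>ne\<close>.
\<close>

type_synonym dart = "nat \<times> bool"

definition flip :: "dart \<Rightarrow> dart" where
  "flip d = (fst d, \<not> snd d)"

datatype 'd vertex =
    Point 'd 'd
  | Trivalent 'd 'd 'd
  | Crossing 'd 'd 'd 'd
  | Marked 'd 'd 'd 'd

fun ends :: "'d vertex \<Rightarrow> 'd list" where
  "ends (Point p q) = [p, q]"
| "ends (Trivalent p q r) = [p, q, r]"
| "ends (Crossing p q r s) = [p, q, r, s]"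
| "ends (Marked p q r s) = [p, q, r, s]"

fun oriented :: "dart vertex \<Rightarrow> bool" where
  "oriented (Point p q) \<longleftrightarrow> snd p \<noteq> snd q"
| "oriented (Trivalent p q r) \<longleftrightarrow> snd p = snd q \<and> snd q = snd r"
| "oriented (Crossing p q r s) \<longleftrightarrow> snd p \<noteq> snd r \<and> snd q \<noteq> snd s"
| "oriented (Marked p q r s) \<longleftrightarrow> snd p = snd r \<and> snd q = snd s \<and> snd p \<noteq> snd q"

fun is_trivalent :: "'d vertex \<Rightarrow> bool" where
  "is_trivalent (Trivalent p q r) \<longleftrightarrow> True"
| "is_trivalent _ \<longleftrightarrow> False"

fun is_marked :: "'d vertex \<Rightarrow> bool" where
  "is_marked (Marked p q r s) \<longleftrightarrow> True"
| "is_marked _ \<longleftrightarrow> False"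

text \<open>
  \<open>reg D d\<close> names the region (component of the complement of the diagram in the sphere) on the
  left of \<open>d\<close> when looking along \<open>d\<close> away from its vertex; the region on the right of \<open>d\<close> is thus
  \<open>reg D (flip d)\<close>. Recording the regions fixes the relative position of the components of a
  disconnected diagram. Only the values on the darts of \<open>D\<close> matter.
\<close>

record diagram =
  verts :: "dart vertex multiset"
  reg :: "dart \<Rightarrow> nat"

definition dart_mset :: "diagram \<Rightarrow> dart multiset" where
  "dart_mset D = (\<Sum>v\<in>#verts D. mset (ends v))"

definition darts :: "diagram \<Rightarrow> dart set" where
  "darts D = set_mset (dart_mset D)"

definition edges :: "diagram \<Rightarrow> nat set" where
  "edges D = fst ` darts D"

definition regions :: "diagram \<Rightarrow> nat set" where
  "regions D = reg D ` darts D"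

text \<open>
  The corner of a vertex between consecutive darts \<open>d\<close>, \<open>d'\<close> (counterclockwise) lies on the left
  of \<open>d\<close> and on the right of \<open>d'\<close>.
\<close>

definition corners_match :: "diagram \<Rightarrow> bool" where
  "corners_match D \<longleftrightarrow> (\<forall>v\<in>#verts D. \<forall>i<length (ends v).
     reg D (ends v ! i) = reg D (flip (ends v ! (Suc i mod length (ends v)))))"

text \<open>
  The closed oriented surface obtained by filling in the regions (each a sphere with holes) is a
  sphere iff it is connected and its first homology with coefficients in the two-element field
  vanishes. In terms of \<open>D\<close>: a set of regions without boundary is empty or contains all regions,
  and every mod 2 cycle \<open>Z\<close> of edges is the boundary of a set of regions.
\<close>

definition edge_boundary :: "diagram \<Rightarrow> nat set \<Rightarrow> nat set" where
  "edge_boundary D R =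
     {e \<in> edges D. (reg D (e, True) \<in> R) \<noteq> (reg D (e, False) \<in> R)}"

definition mod2_cycle :: "diagram \<Rightarrow> nat set \<Rightarrow> bool" where
  "mod2_cycle D Z \<longleftrightarrow> Z \<subseteq> edges D \<and>
     (\<forall>v\<in>#verts D. even (card {d \<in> set (ends v). fst d \<in> Z}))"

definition spherical :: "diagram \<Rightarrow> bool" where
  "spherical D \<longleftrightarrow>
     (\<forall>R\<subseteq>regions D. edge_boundary D R = {} \<longrightarrow> R = {} \<or> R = regions D) \<and>
     (\<forall>Z. mod2_cycle D Z \<longrightarrow> (\<exists>R\<subseteq>regions D. edge_boundary D R = Z))"

definition plane_diagram :: "diagram \<Rightarrow> bool" where
  "plane_diagram D \<longleftrightarrow>
     verts D \<noteq> {#} \<and>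
     (\<forall>d. count (dart_mset D) d \<le> 1) \<and>
     (\<forall>d\<in>darts D. flip d \<in> darts D) \<and>
     (\<forall>v\<in>#verts D. oriented v) \<and>
     corners_match D \<and>
     spherical D"

definition marked_graph_diagram :: "diagram \<Rightarrow> bool" where
  "marked_graph_diagram D \<longleftrightarrow> plane_diagram D \<and> (\<forall>v\<in>#verts D. \<not> is_trivalent v)"

definition trivalent_graph_diagram :: "diagram \<Rightarrow> bool" where
  "trivalent_graph_diagram D \<longleftrightarrow> plane_diagram D \<and> (\<forall>v\<in>#verts D. \<not> is_marked v)"


section \<open>Planar isotopy\<close>

text \<open>The same vertex, with its darts listed from a different starting point.\<close>

fun rotations :: "'d vertex \<Rightarrow> 'd vertex set" where
  "rotations (Point p q) = {Point p q, Point q p}"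
| "rotations (Trivalent p q r) = {Trivalent p q r, Trivalent q r p, Trivalent r p q}"
| "rotations (Crossing p q r s) = {Crossing p q r s, Crossing r s p q}"
| "rotations (Marked p q r s) = {Marked p q r s, Marked r s p q}"

definition relabelled :: "diagram \<Rightarrow> diagram \<Rightarrow> bool" where
  "relabelled D E \<longleftrightarrow> (\<exists>f g. inj_on f (edges D) \<and> inj_on g (regions D) \<and>
     rel_mset (\<lambda>v w. w \<in> rotations (map_vertex (map_prod f id) v)) (verts D) (verts E) \<and>
     (\<forall>d\<in>darts D. reg E (map_prod f id d) = g (reg D d)))"

text \<open>\<open>subdivide D e e'\<close>: insert a point on \<open>e\<close>; the part of \<open>e\<close> behind it is named \<open>e'\<close>.\<close>

definition subdivide :: "diagram \<Rightarrow> nat \<Rightarrow> nat \<Rightarrow> diagram" where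
  "subdivide D e e' =
     \<lparr>verts = image_mset (map_vertex (id((e, False) := (e', False)))) (verts D)
              + {#Point (e, False) (e', True)#},
      reg = (\<lambda>d. if fst d = e' then reg D (e, snd d) else reg D d)\<rparr>"

inductive isotopic :: "diagram \<Rightarrow> diagram \<Rightarrow> bool" where
  relabel: "plane_diagram D \<Longrightarrow> plane_diagram E \<Longrightarrow> relabelled D E \<Longrightarrow> isotopic D E"
| subdivide: "plane_diagram D \<Longrightarrow> plane_diagram (subdivide D e e') \<Longrightarrow>
    e \<in> edges D \<Longrightarrow> e' \<notin> edges D \<Longrightarrow> isotopic D (subdivide D e e')"
| sym: "isotopic D E \<Longrightarrow> isotopic E D"
| trans: "isotopic D E \<Longrightarrow> isotopic E F \<Longrightarrow> isotopic D F"


section \<open>Local modifications\<close>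

definition merge :: "nat \<Rightarrow> nat \<Rightarrow> (dart \<Rightarrow> nat) \<Rightarrow> dart \<Rightarrow> nat" where
  "merge r r' f d = (if f d = r' then r else f d)"

text \<open>
  Delete the connected piece \<open>T\<close>, lying in a disk with boundary ends \<open>p, q, r, s\<close> in
  counterclockwise order, and join \<open>p\<close> with \<open>q\<close> and \<open>r\<close> with \<open>s\<close> by disjoint arcs. The region
  between \<open>q\<close> and \<open>r\<close> and the region between \<open>s\<close> and \<open>p\<close> become one.
\<close>

definition rejoin ::
  "diagram \<Rightarrow> dart vertex multiset \<Rightarrow> dart \<Rightarrow> dart \<Rightarrow> dart \<Rightarrow> dart \<Rightarrow> diagram" where
  "rejoin D T p q r s =
     \<lparr>verts = verts D - T + {#Point p q, Point r s#},
      reg = merge (reg D q) (reg D s) (reg D)\<rparr>"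

text \<open>
  \<open>F\<close> is the set of all sides of edges that face some region. If \<open>F\<close> is a single boundary cycle,
  as in all uses below, then that region is a disk disjoint from the diagram.
\<close>

definition is_face :: "diagram \<Rightarrow> dart set \<Rightarrow> bool" where
  "is_face D F \<longleftrightarrow> (\<exists>r\<in>regions D. F = {d \<in> darts D. reg D d = r})"

text \<open>
  \<open>D \<squnion> O\<close>, with the circle \<open>e\<close> placed in the region on the left of \<open>d\<close>; \<open>n\<close> is the name of the
  disk bounded by it and \<open>b\<close> tells whether the circle runs counterclockwise around this disk.
\<close>

definition add_circle :: "diagram \<Rightarrow> dart \<Rightarrow> nat \<Rightarrow> bool \<Rightarrow> nat \<Rightarrow> diagram" where
  "add_circle D d e b n =
     \<lparr>verts = verts D + {#Point (e, False) (e, True)#},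
      reg = (reg D)((e, b) := n, (e, \<not> b) := reg D d)\<rparr>"

text \<open>
  \<open>D\<^sub>H\<close> for a crossing \<open>v\<close> whose darts are, counterclockwise, \<open>i1, i2\<close> (incoming) and \<open>o1, o2\<close>
  (outgoing); \<open>e\<close> is the new edge.
\<close>

definition H_graph ::
  "diagram \<Rightarrow> dart vertex \<Rightarrow> dart \<Rightarrow> dart \<Rightarrow> dart \<Rightarrow> dart \<Rightarrow> nat \<Rightarrow> diagram" where
  "H_graph D v i1 i2 o1 o2 e =
     \<lparr>verts = verts D - {#v#} + {#Trivalent i1 i2 (e, False), Trivalent o1 o2 (e, True)#},
      reg = (reg D)((e, True) := reg D i2, (e, False) := reg D o2)\<rparr>"


section \<open>Regular isotopy\<close>

text \<open>
  Reidemeister moves of type II and III, and passing a strand over or under a trivalent vertex.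

  In \<open>R2\<close> the upper strand \<open>s\<close>--\<open>t\<close> is pulled off the lower strand \<open>p\<close>--\<open>q\<close>.
  In \<open>R3\<close> the horizontal strand \<open>t0\<close>--\<open>t1\<close> lies above two diagonal strands, \<open>a0\<close>--\<open>a1\<close> from
  south west to north east and \<open>b0\<close>--\<open>b1\<close> from south east to north west, and is moved from the
  south to the north of their crossing; the two rules differ in the crossing of the diagonals.
  In \<open>over_vertex\<close> and \<open>under_vertex\<close> a horizontal strand \<open>t0\<close>--\<open>t1\<close> is moved from the south
  to the north of a trivalent vertex with legs \<open>a\<close> (north east), \<open>b\<close> (north west) and \<open>c\<close> (south).
\<close>

definition R3_reg :: "diagram \<Rightarrow> dart \<Rightarrow> dart \<Rightarrow> dart \<Rightarrow> dart \<Rightarrow> dart \<Rightarrow> dart \<Rightarrow> dart \<Rightarrow> nat" where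
  "R3_reg D a1 b0 t0 f g h = (reg D)(
     g := reg D h, flip h := reg D h, flip f := reg D h,
     flip g := reg D b0, f := reg D t0, h := reg D a1)"

definition vertex_reg ::
  "diagram \<Rightarrow> nat \<Rightarrow> dart \<Rightarrow> dart \<Rightarrow> dart \<Rightarrow> dart \<Rightarrow> dart \<Rightarrow> dart \<Rightarrow> dart \<Rightarrow> nat" where
  "vertex_reg D n a c t0 f k h = (reg D)(
     f := n, flip h := n, flip k := n,
     flip f := reg D c, k := reg D t0, h := reg D a)"

inductive regular_move :: "diagram \<Rightarrow> diagram \<Rightarrow> bool" where
  R2: "T = {#Crossing p s m k, Crossing (flip m) t q (flip k)#} \<Longrightarrow> T \<subseteq># verts D \<Longrightarrow>
    is_face D {m, flip k} \<Longrightarrow> regular_move D (rejoin D T q p s t)"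
| R3_upper_a: "T = {#Crossing a0 h g t0, Crossing b0 t1 f (flip h),
         Crossing b1 (flip g) (flip f) a1#} \<Longrightarrow> T \<subseteq># verts D \<Longrightarrow>
    is_face D {h, f, flip g} \<Longrightarrow>
    regular_move D \<lparr>verts = verts D - T + {#Crossing a1 (flip h) (flip g) t1,
         Crossing b1 t0 (flip f) h, Crossing f a0 b0 g#},
       reg = R3_reg D a1 b0 t0 f g h\<rparr>"
| R3_upper_b: "T = {#Crossing a0 h g t0, Crossing b0 t1 f (flip h),
         Crossing a1 b1 (flip g) (flip f)#} \<Longrightarrow> T \<subseteq># verts D \<Longrightarrow>
    is_face D {h, f, flip g} \<Longrightarrow>
    regular_move D \<lparr>verts = verts D - T + {#Crossing a1 (flip h) (flip g) t1,
         Crossing b1 t0 (flip f) h, Crossing g f a0 b0#},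
       reg = R3_reg D a1 b0 t0 f g h\<rparr>"
| over_vertex: "T = {#Trivalent a b m, Crossing c t1 (flip m) t0#} \<Longrightarrow> T \<subseteq># verts D \<Longrightarrow>
    distinct [e1, e2, e3] \<Longrightarrow> {e1, e2, e3} \<inter> edges D = {} \<Longrightarrow> n \<notin> regions D \<Longrightarrow>
    f = (e1, snd c) \<Longrightarrow> k = (e2, snd c) \<Longrightarrow> h = (e3, \<not> snd t0) \<Longrightarrow>
    regular_move D \<lparr>verts = verts D - T + {#Trivalent f k c,
         Crossing a (flip h) (flip f) t1, Crossing b t0 (flip k) h#},
       reg = vertex_reg D n a c t0 f k h\<rparr>"
| under_vertex: "T = {#Trivalent a b m, Crossing t1 (flip m) t0 c#} \<Longrightarrow> T \<subseteq># verts D \<Longrightarrow>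
    distinct [e1, e2, e3] \<Longrightarrow> {e1, e2, e3} \<inter> edges D = {} \<Longrightarrow> n \<notin> regions D \<Longrightarrow>
    f = (e1, snd c) \<Longrightarrow> k = (e2, snd c) \<Longrightarrow> h = (e3, \<not> snd t0) \<Longrightarrow>
    regular_move D \<lparr>verts = verts D - T + {#Trivalent f k c,
         Crossing (flip h) (flip f) t1 a, Crossing t0 (flip k) h b#},
       reg = vertex_reg D n a c t0 f k h\<rparr>"


section \<open>Kuperberg's bracket\<close>

text \<open>
  Laurent polynomials in \<open>a\<close> are the finitely supported functions from the exponents to the
  integers, with the convolution product.
\<close>

type_synonym laurent = "int \<Rightarrow>\<^sub>0 int"

definition a_pow :: "int \<Rightarrow> laurent" where
  "a_pow k = Poly_Mapping.single k 1"

definition isotopy_invariant :: "(diagram \<Rightarrow> laurent) \<Rightarrow> bool" where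
  "isotopy_invariant br \<longleftrightarrow>
     (\<forall>D E. trivalent_graph_diagram D \<and> trivalent_graph_diagram E \<and> isotopic D E
        \<longrightarrow> br D = br E)"

definition regular_move_invariant :: "(diagram \<Rightarrow> laurent) \<Rightarrow> bool" where
  "regular_move_invariant br \<longleftrightarrow>
     (\<forall>D E. trivalent_graph_diagram D \<and> regular_move D E \<longrightarrow> br D = br E)"

definition unknot_value :: "(diagram \<Rightarrow> laurent) \<Rightarrow> bool" where
  "unknot_value br \<longleftrightarrow>
     (\<forall>D e. trivalent_graph_diagram D \<and> verts D = {#Point (e, False) (e, True)#}
        \<longrightarrow> br D = 1)"

definition circle_relation :: "(diagram \<Rightarrow> laurent) \<Rightarrow> bool" where
  "circle_relation br \<longleftrightarrow>
     (\<forall>D d e b n. trivalent_graph_diagram D \<and> d \<in> darts D \<and> e \<notin> edges D \<and> n \<notin> regions D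
        \<longrightarrow> br (add_circle D d e b n) = (a_pow (-6) + 1 + a_pow 6) * br D)"

definition bigon_relation :: "(diagram \<Rightarrow> laurent) \<Rightarrow> bool" where
  "bigon_relation br \<longleftrightarrow>
     (\<forall>D T p q b c. trivalent_graph_diagram D \<and>
        T = {#Trivalent p (c, False) (b, False), Trivalent q (b, True) (c, True)#} \<and>
        T \<subseteq># verts D \<and> is_face D {(c, False), (b, True)}
        \<longrightarrow> br D = (a_pow (-3) + a_pow 3) *
              br \<lparr>verts = verts D - T + {#Point p q#}, reg = reg D\<rparr>)"

text \<open>
  The legs \<open>p0, p1, p2, p3\<close> of the square are listed in counterclockwise order, starting at a
  sink.
\<close>

definition square_relation :: "(diagram \<Rightarrow> laurent) \<Rightarrow> bool" where
  "square_relation br \<longleftrightarrow>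
     (\<forall>D T p0 p1 p2 p3 e0 e1 e2 e3. trivalent_graph_diagram D \<and>
        T = {#Trivalent p0 (e0, False) (e3, False), Trivalent p1 (e1, True) (e0, True),
              Trivalent p2 (e2, False) (e1, False), Trivalent p3 (e3, True) (e2, True)#} \<and>
        T \<subseteq># verts D \<and> is_face D {(e0, False), (e1, True), (e2, False), (e3, True)}
        \<longrightarrow> br D = br (rejoin D T p0 p1 p2 p3) + br (rejoin D T p1 p2 p3 p0))"

text \<open>
  In a crossing \<open>Crossing p q r s\<close> with \<open>p\<close> incoming, the upper strand crosses the lower one from
  left to right (positive crossing) iff \<open>q\<close> is outgoing. That \<open>p\<close> is incoming can always be
  achieved by listing the crossing the other way round.
\<close>

definition positive_crossing_relation :: "(diagram \<Rightarrow> laurent) \<Rightarrow> bool" where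
  "positive_crossing_relation br \<longleftrightarrow>
     (\<forall>D v p q r s e. trivalent_graph_diagram D \<and> v = Crossing p q r s \<and> v \<in># verts D \<and>
        \<not> snd p \<and> snd q \<and> e \<notin> edges D
        \<longrightarrow> br D = - a_pow 1 * br (H_graph D v s p q r e)
                   + a_pow (-2) * br (rejoin D {#v#} p q r s))"

definition negative_crossing_relation :: "(diagram \<Rightarrow> laurent) \<Rightarrow> bool" where
  "negative_crossing_relation br \<longleftrightarrow>
     (\<forall>D v p q r s e. trivalent_graph_diagram D \<and> v = Crossing p q r s \<and> v \<in># verts D \<and>
        \<not> snd p \<and> \<not> snd q \<and> e \<notin> edges D
        \<longrightarrow> br D = - a_pow (-1) * br (H_graph D v p q r s e)
                   + a_pow 2 * br (rejoin D {#v#} q r s p))"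

text \<open>
  These properties determine \<open>br\<close> on all trivalent graph diagrams.
\<close>

definition A2_bracket :: "(diagram \<Rightarrow> laurent) \<Rightarrow> bool" where
  "A2_bracket br \<longleftrightarrow>
     isotopy_invariant br \<and> regular_move_invariant br \<and>
     unknot_value br \<and> circle_relation br \<and> bigon_relation br \<and> square_relation br \<and>
     positive_crossing_relation br \<and> negative_crossing_relation br"


section \<open>The polynomial of a marked graph diagram\<close>

text \<open>
  Coefficients are Laurent polynomials in \<open>a\<close>; \<open>x\<close> is the inner and \<open>y\<close> the outer variable.
\<close>

type_synonym poly_axy = "laurent poly poly"

definition const_axy :: "laurent \<Rightarrow> poly_axy" where
  "const_axy c = [:[:c:]:]"

definition var_x :: poly_axy where
  "var_x = [:[:0, 1:]:]"

definition var_y :: poly_axy where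
  "var_y = [:0, 1:]"

definition positive_resolution ::
  "diagram \<Rightarrow> dart \<Rightarrow> dart \<Rightarrow> dart \<Rightarrow> dart \<Rightarrow> diagram" where
  "positive_resolution D ne nw sw se = rejoin D {#Marked ne nw sw se#} ne nw sw se"

definition negative_resolution ::
  "diagram \<Rightarrow> dart \<Rightarrow> dart \<Rightarrow> dart \<Rightarrow> dart \<Rightarrow> diagram" where
  "negative_resolution D ne nw sw se = rejoin D {#Marked ne nw sw se#} nw sw se ne"

text \<open>
  The recursion may resolve the marked vertices in any order; \<open>marked_value br D\<close> relates \<open>D\<close> to
  the result of every possible computation.
\<close>

inductive marked_value :: "(diagram \<Rightarrow> laurent) \<Rightarrow> diagram \<Rightarrow> poly_axy \<Rightarrow> bool"
  for br :: "diagram \<Rightarrow> laurent" where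
  unmarked: "(\<forall>v\<in>#verts D. \<not> is_marked v) \<Longrightarrow> marked_value br D (const_axy (br D))"
| resolve: "Marked ne nw sw se \<in># verts D \<Longrightarrow>
    marked_value br (positive_resolution D ne nw sw se) P \<Longrightarrow>
    marked_value br (negative_resolution D ne nw sw se) N \<Longrightarrow>
    marked_value br D (var_x * P + var_y * N)"

definition marked_bracket :: "(diagram \<Rightarrow> laurent) \<Rightarrow> diagram \<Rightarrow> poly_axy" where
  "marked_bracket br D = (THE P. marked_value br D P)"

fun vertex_sign :: "dart vertex \<Rightarrow> int" where
  "vertex_sign (Crossing p q r s) = (if snd p \<noteq> snd q then 1 else - 1)"
| "vertex_sign _ = 0"

definition writhe :: "diagram \<Rightarrow> int" where
  "writhe D = (\<Sum>v\<in>#verts D. vertex_sign v)"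

definition marked_polynomial :: "(diagram \<Rightarrow> laurent) \<Rightarrow> diagram \<Rightarrow> poly_axy" where
  "marked_polynomial br D = const_axy (a_pow (8 * writhe D)) * marked_bracket br D"


section \<open>The moves creating marked curls\<close>

text \<open>
  The arc through the point \<open>Point p q\<close> is replaced by a marked vertex with a loop \<open>l\<close> that
  bounds a disk \<open>n\<close>. The loop joins the north ends for \<open>curl6\<close> (no marker end in the disk) and
  the west ends for \<open>curl6'\<close> (one marker end in the disk); the cases south and east differ from
  these by a half turn. Which side of the arc the loop lies on depends on the order of \<open>p\<close> and
  \<open>q\<close>. The direction of \<open>l\<close> is forced by the orientation condition at the marked vertex.
\<close>

inductive curl6 :: "diagram \<Rightarrow> diagram \<Rightarrow> bool" where
  "Point p q \<in># verts D \<Longrightarrow> l \<notin> edges D \<Longrightarrow> n \<notin> regions D \<Longrightarrow>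
   curl6 D
     \<lparr>verts = verts D - {#Point p q#} + {#Marked (l, snd p) (l, \<not> snd p) p q#},
      reg = (reg D)((l, snd p) := n, (l, \<not> snd p) := reg D q)\<rparr>"

inductive curl6' :: "diagram \<Rightarrow> diagram \<Rightarrow> bool" where
  "Point p q \<in># verts D \<Longrightarrow> l \<notin> edges D \<Longrightarrow> n \<notin> regions D \<Longrightarrow>
   curl6' D
     \<lparr>verts = verts D - {#Point p q#} + {#Marked p (l, \<not> snd p) (l, snd p) q#},
      reg = (reg D)((l, \<not> snd p) := n, (l, snd p) := reg D p)\<rparr>"

definition Gamma6 :: "diagram \<Rightarrow> diagram \<Rightarrow> bool" where
  "Gamma6 D0 D \<longleftrightarrow> (\<exists>E0 E. isotopic D0 E0 \<and> curl6 E0 E \<and> isotopic E D)"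

definition Gamma6' :: "diagram \<Rightarrow> diagram \<Rightarrow> bool" where
  "Gamma6' D0 D \<longleftrightarrow> (\<exists>E0 E. isotopic D0 E0 \<and> curl6' E0 E \<and> isotopic E D)"

end

theory Submission
  imports Defs
begin

text \<open>
  Resolving the marked vertex of a marked curl in one way cuts off its loop as a disjoint circle, and
  resolving it in the other way straightens the curl to the original arc. So the skein relation at
  this vertex expresses \<open>[[D]]\<close> as a combination of \<open>[[D\<^sub>0 \<squnion> O]]\<close> and \<open>[[D\<^sub>0]]\<close>, where
  the circle contributes the factor \<open>a\<^sup>-\<^sup>6 + 1 + a\<^sup>6\<close>; the writhe does not change.

  The substance lies in making this computation legitimate. The polynomial is defined by resolving
  marked vertices in an arbitrary order, and the bracket is invariant only under isotopy of plane
  diagrams. Therefore three facts are established first.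

  \<^item> Resolving a marked vertex of a plane diagram yields a plane diagram
    (\<open>plane_diagram_resolution\<close>). Since planarity is expressed by the mod 2 homology of the surface
    made from the regions, this is a short parity argument at the vertex.
  \<^item> Isotopic diagrams have corresponding marked vertices with isotopic resolutions
    (\<open>resolutions_matched_isotopic\<close>), and resolutions at different vertices commute up to the names
    of the regions (\<open>resolutions_commute\<close>).
  \<^item> Hence all computations give the same value, and isotopic diagrams have the same value
    (\<open>marked_value_unique\<close>), by induction on the number of marked vertices.

  With this, the skein relation holds at each marked vertex (\<open>marked_bracket_resolve\<close>) and
  the relation for circles extends to diagrams with marked vertices (\<open>marked_bracket_add_circle\<close>).
  It remains to recognise the resolutions of a marked curl up to isotopy (\<open>curl6_resolutions\<close>,
  \<open>curl6'_resolutions\<close>).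
\<close>

section \<open>Corners, darts and regions\<close>

fun corners_at :: "(dart \<Rightarrow> nat) \<Rightarrow> dart vertex \<Rightarrow> bool" where
  "corners_at f (Point p q) \<longleftrightarrow> f p = f (flip q) \<and> f q = f (flip p)"
| "corners_at f (Trivalent p q r) \<longleftrightarrow> f p = f (flip q) \<and> f q = f (flip r) \<and> f r = f (flip p)"
| "corners_at f (Crossing p q r s) \<longleftrightarrow>
     f p = f (flip q) \<and> f q = f (flip r) \<and> f r = f (flip s) \<and> f s = f (flip p)"
| "corners_at f (Marked p q r s) \<longleftrightarrow>
     f p = f (flip q) \<and> f q = f (flip r) \<and> f r = f (flip s) \<and> f s = f (flip p)"

lemma corners_match_iff: "corners_match D \<longleftrightarrow> (\<forall>v\<in>#verts D. corners_at (reg D) v)"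
proof -
  have "(\<forall>i<length (ends v). reg D (ends v ! i) = reg D (flip (ends v ! (Suc i mod length (ends v)))))
      \<longleftrightarrow> corners_at (reg D) v" for v
    by (cases v) (auto simp: All_less_Suc)
  then show ?thesis
    by (simp add: corners_match_def)
qed

lemma darts_iff: "d \<in> darts D \<longleftrightarrow> (\<exists>v\<in>#verts D. d \<in> set (ends v))"
  by (auto simp: darts_def dart_mset_def)

lemma edges_iff: "e \<in> edges D \<longleftrightarrow> (\<exists>b. (e, b) \<in> darts D)"
  by (force simp: edges_def)

lemma plane_diagram_flip: "plane_diagram D \<Longrightarrow> d \<in> darts D \<Longrightarrow> flip d \<in> darts D"
  by (simp add: plane_diagram_def)

lemma edge_in_both_directions:
  assumes "plane_diagram D" "e \<in> edges D"
  shows "(e, b) \<in> darts D"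
proof -
  obtain c where "(e, c) \<in> darts D"
    using assms(2) by (auto simp: edges_iff)
  then show ?thesis
    using plane_diagram_flip[OF assms(1), of "(e, c)"] by (cases "b = c") (auto simp: flip_def)
qed


section \<open>Resolving a marked vertex of a plane diagram\<close>

lemma dart_mset_rejoin:
  assumes "v \<in># verts D" "mset (ends v) = {#p, q, r, s#}"
  shows "dart_mset (rejoin D {#v#} p q r s) = dart_mset D"
  using assms by (auto simp: dart_mset_def rejoin_def dest!: multi_member_split)

text \<open>
  Joining the four ends of a marked vertex in two neighbouring pairs keeps all edges and replaces
  two opposite regions by their union, so only the two homological conditions need an argument.
  A set of regions of the new diagram is the same as a set of old regions that does not separate
  the merged pair, with the same boundary; this transfers the first condition. A cycle
  \<open>Z\<close> of the new diagram is a cycle of the old one, hence the boundary of a set \<open>R\<close> of old regions.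
  As \<open>Z\<close> contains both or none of the joined ends \<open>p\<close> and \<open>q\<close>, walking around the vertex across
  \<open>p\<close> and \<open>q\<close> shows that \<open>R\<close> contains both or none of the merged regions.
\<close>

lemma plane_diagram_rejoin:
  assumes D: "plane_diagram D" and v: "v \<in># verts D"
    and v_eq: "v = Marked p q r s \<or> v = Marked s p q r"
  shows "plane_diagram (rejoin D {#v#} p q r s)" (is "plane_diagram ?E")
proof -
  define m where "m x = (if x = reg D s then reg D q else x)" for x
  have reg: "reg ?E d = m (reg D d)" for d
    by (simp add: rejoin_def merge_def m_def)
  have dm: "dart_mset ?E = dart_mset D"
    using v v_eq by (intro dart_mset_rejoin) auto
  have darts: "darts ?E = darts D" and edges: "edges ?E = edges D"
    by (simp_all add: darts_def edges_def dm)
  have regions: "regions ?E = m ` regions D"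
    by (auto simp: regions_def darts reg image_image)
  have vE: "w \<in># verts ?E \<Longrightarrow> w \<in># verts D \<or> w = Point p q \<or> w = Point r s" for w
    by (auto simp: rejoin_def dest: in_diffD)
  have orv: "oriented v" and cv: "corners_at (reg D) v"
    using D v by (auto simp: plane_diagram_def corners_match_iff)
  have in_darts: "p \<in> darts D" "q \<in> darts D" "r \<in> darts D" "s \<in> darts D"
    using v v_eq by (auto simp: darts_iff intro!: bexI[of _ v])
  have oriented: "\<forall>w\<in>#verts ?E. oriented w"
    using D orv v_eq by (auto simp: plane_diagram_def dest!: vE)
  have "corners_at (reg ?E) w" if "w \<in># verts ?E" for w
    using vE[OF that]
  proof (elim disjE)
    assume "w \<in># verts D"
    then have "corners_at (reg D) w"
      using D by (auto simp: plane_diagram_def corners_match_iff)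
    then show ?thesis
      by (cases w) (auto simp: reg)
  qed (use cv v_eq in \<open>auto simp: reg m_def\<close>)
  then have corners: "corners_match ?E"
    by (simp add: corners_match_iff)
  have boundary: "edge_boundary ?E R = edge_boundary D {x \<in> regions D. m x \<in> R}" for R
  proof -
    have "reg D (e, b) \<in> regions D" if "e \<in> edges D" for e b
      using edge_in_both_directions[OF D that] by (simp add: regions_def)
    then show ?thesis
      by (auto simp: edge_boundary_def edges reg)
  qed
  have sph: "\<forall>R\<subseteq>regions D. edge_boundary D R = {} \<longrightarrow> R = {} \<or> R = regions D"
    and cyc: "\<forall>Z. mod2_cycle D Z \<longrightarrow> (\<exists>R\<subseteq>regions D. edge_boundary D R = Z)"
    using D by (auto simp: plane_diagram_def spherical_def)
  have "R = {} \<or> R = regions ?E" if R: "R \<subseteq> regions ?E" "edge_boundary ?E R = {}" for R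
  proof -
    have "{x \<in> regions D. m x \<in> R} = {} \<or> {x \<in> regions D. m x \<in> R} = regions D"
      using R(2) by (intro sph[rule_format]) (auto simp: boundary)
    then show ?thesis
      using R(1) by (auto simp: regions)
  qed
  moreover have "\<exists>R\<subseteq>regions ?E. edge_boundary ?E R = Z" if Z: "mod2_cycle ?E Z" for Z
  proof -
    have "distinct [p, q, r, s]"
    proof -
      have "count (dart_mset D) d \<le> 1" for d
        using D unfolding plane_diagram_def by blast
      moreover have "mset (ends v) \<subseteq># dart_mset D"
        using v by (auto simp: dart_mset_def dest!: multi_member_split)
      ultimately have "count (mset (ends v)) d \<le> 1" for d
        by (meson le_trans mset_subset_eq_count)
      from this[of p] this[of q] this[of r] this[of s] show ?thesis
        using v_eq by (auto split: if_splits)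
    qed
    then have dist: "p \<noteq> q" "r \<noteq> s" "p \<noteq> r" "p \<noteq> s" "q \<noteq> r" "q \<noteq> s"
      by auto
    have pts: "Point p q \<in># verts ?E" "Point r s \<in># verts ?E"
      by (simp_all add: rejoin_def)
    have pq: "fst p \<in> Z \<longleftrightarrow> fst q \<in> Z" if "p \<noteq> q" "Point p q \<in># verts ?E" for p q
    proof -
      have "even (card {d \<in> {p, q}. fst d \<in> Z})"
        using Z that(2) by (force simp: mod2_cycle_def)
      moreover have "{d \<in> {p, q}. fst d \<in> Z} =
          (if fst p \<in> Z then {p} else {}) \<union> (if fst q \<in> Z then {q} else {})"
        by auto
      ultimately show ?thesis
        using that(1) by (auto split: if_splits)
    qed
    note Zpq = pq[OF dist(1) pts(1)] and Zrs = pq[OF dist(2) pts(2)]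
    have "even (card {d \<in> set (ends w). fst d \<in> Z})" if w: "w \<in># verts D" for w
    proof (cases "w = v")
      case True
      have "{d \<in> {p, q, r, s}. fst d \<in> Z} =
          (if fst p \<in> Z then {p, q} else {}) \<union> (if fst r \<in> Z then {r, s} else {})"
        using Zpq Zrs by auto
      moreover have "set (ends w) = {p, q, r, s}"
        using v_eq True by auto
      ultimately show ?thesis
        using dist by auto
    next
      case False
      then have "w \<in># verts ?E"
        using w by (simp add: rejoin_def in_diff_count)
      then show ?thesis
        using Z by (auto simp: mod2_cycle_def)
    qed
    then have "mod2_cycle D Z"
      using Z by (auto simp: mod2_cycle_def edges)
    then obtain R where R: "R \<subseteq> regions D" "edge_boundary D R = Z"
      using cyc by auto
    have edge_Z: "fst d \<in> Z \<longleftrightarrow> (reg D d \<in> R) \<noteq> (reg D (flip d) \<in> R)" if "d \<in> darts D" for d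
    proof -
      have "fst d \<in> edges D"
        using that by (simp add: edges_def)
      then show ?thesis
        by (cases d; cases "snd d") (auto simp: R(2)[symmetric] edge_boundary_def flip_def)
    qed
    \<comment> \<open>The corner between \<open>p\<close> and \<open>q\<close> is left by crossing \<open>p\<close> into the region named \<open>reg D s\<close> and by
      crossing \<open>q\<close> into the region named \<open>reg D q\<close>.\<close>
    have "reg D q \<in> R \<longleftrightarrow> reg D s \<in> R"
      using cv v_eq Zpq edge_Z[OF in_darts(1)] edge_Z[OF in_darts(2)] by auto
    then have "{x \<in> regions D. m x \<in> m ` R} = R"
      using R(1) by (auto simp: m_def split: if_splits)
    then have "edge_boundary ?E (m ` R) = Z"
      by (simp add: boundary R(2))
    moreover have "m ` R \<subseteq> regions ?E"
      using R(1) by (auto simp: regions)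
    ultimately show ?thesis
      by blast
  qed
  ultimately have "spherical ?E"
    by (simp add: spherical_def)
  moreover have "verts ?E \<noteq> {#}"
    by (simp add: rejoin_def)
  ultimately show ?thesis
    using D oriented corners by (simp add: plane_diagram_def dm darts)
qed

text \<open>
  The Boolean selects the sign of the resolution. Both signs are instances of \<open>rejoin\<close>, up to a
  cyclic shift of the four ends, so that most arguments need to be given only once.
\<close>

fun resolution :: "bool \<Rightarrow> diagram \<Rightarrow> dart vertex \<Rightarrow> diagram" where
  "resolution b D (Marked ne nw sw se) =
     (if b then positive_resolution D ne nw sw se else negative_resolution D ne nw sw se)"
| "resolution b D v = D"

lemma resolution_eq_rejoin:
  assumes "is_marked v"
  shows "\<exists>p q r s. (v = Marked p q r s \<or> v = Marked s p q r) \<and>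
    (\<forall>D. resolution b D v = rejoin D {#v#} p q r s)"
proof (cases v)
  case (Marked ne nw sw se)
  show ?thesis
  proof (cases b)
    case True
    then show ?thesis
      using Marked by (intro exI[of _ ne] exI[of _ nw] exI[of _ sw] exI[of _ se])
        (simp add: positive_resolution_def)
  next
    case False
    then show ?thesis
      using Marked by (intro exI[of _ nw] exI[of _ sw] exI[of _ se] exI[of _ ne])
        (simp add: negative_resolution_def)
  qed
qed (use assms in auto)

lemma plane_diagram_resolution:
  assumes "plane_diagram D" "v \<in># verts D"
  shows "plane_diagram (resolution b D v)"
proof (cases "is_marked v")
  case True
  then obtain p q r s where "v = Marked p q r s \<or> v = Marked s p q r"
    "resolution b D v = rejoin D {#v#} p q r s"
    using resolution_eq_rejoin[of v b] by blast
  then show ?thesis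
    using plane_diagram_rejoin[OF assms] by simp
next
  case False
  then show ?thesis
    using assms by (cases v) auto
qed

lemma dart_mset_resolution:
  assumes "v \<in># verts D"
  shows "dart_mset (resolution b D v) = dart_mset D"
proof (cases v)
  case (Marked p q r s)
  then show ?thesis
    using assms by (auto simp: positive_resolution_def negative_resolution_def dart_mset_rejoin)
qed (use assms in auto)

lemma darts_resolution: "v \<in># verts D \<Longrightarrow> darts (resolution b D v) = darts D"
  and edges_resolution: "v \<in># verts D \<Longrightarrow> edges (resolution b D v) = edges D"
  by (simp_all add: darts_def edges_def dart_mset_resolution)

section \<open>Relabelling\<close>

text \<open>
  Merging regions depends on which of the two names survives, so resolved diagrams agree only up to
  the names of their regions. This relation therefore compares just the partition of the darts into
  regions: a renaming of the regions need not be exhibited, as \<open>relabelled_iff\<close> reconstructs it.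
  For \<open>f = id\<close> the edges keep their names.
\<close>

definition redrawn :: "(nat \<Rightarrow> nat) \<Rightarrow> diagram \<Rightarrow> diagram \<Rightarrow> bool" where
  "redrawn f D E \<longleftrightarrow>
     rel_mset (\<lambda>v w. w \<in> rotations (map_vertex (map_prod f id) v)) (verts D) (verts E) \<and>
     (\<forall>d\<in>darts D. \<forall>d'\<in>darts D.
        reg E (map_prod f id d) = reg E (map_prod f id d') \<longleftrightarrow> reg D d = reg D d')"

lemma relabelled_iff: "relabelled D E \<longleftrightarrow> (\<exists>f. inj_on f (edges D) \<and> redrawn f D E)"
proof
  assume "relabelled D E"
  then obtain f g where f: "inj_on f (edges D)" and g: "inj_on g (regions D)"
    and "rel_mset (\<lambda>v w. w \<in> rotations (map_vertex (map_prod f id) v)) (verts D) (verts E)"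
    and reg: "\<forall>d\<in>darts D. reg E (map_prod f id d) = g (reg D d)"
    unfolding relabelled_def by blast
  moreover have "g (reg D d) = g (reg D d') \<longleftrightarrow> reg D d = reg D d'"
    if "d \<in> darts D" "d' \<in> darts D" for d d'
    using g that by (auto simp: regions_def dest: inj_onD)
  ultimately show "\<exists>f. inj_on f (edges D) \<and> redrawn f D E"
    unfolding redrawn_def by (intro exI[of _ f]) simp
next
  assume "\<exists>f. inj_on f (edges D) \<and> redrawn f D E"
  then obtain f where f: "inj_on f (edges D)" "redrawn f D E"
    by blast
  \<comment> \<open>Rename a region by looking at any dart on its boundary.\<close>
  define pick where "pick x = (SOME d. d \<in> darts D \<and> reg D d = x)" for x
  have pick: "pick (reg D d) \<in> darts D \<and> reg D (pick (reg D d)) = reg D d" if "d \<in> darts D" for d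
    unfolding pick_def using someI[of "\<lambda>c. c \<in> darts D \<and> reg D c = reg D d" d] that by simp
  define g where "g x = reg E (map_prod f id (pick x))" for x
  have "reg E (map_prod f id d) = g (reg D d)" if "d \<in> darts D" for d
  proof -
    have "reg E (map_prod f id d) = reg E (map_prod f id (pick (reg D d)))"
      using f(2) that pick[OF that] unfolding redrawn_def by simp
    then show ?thesis
      by (simp add: g_def)
  qed
  moreover have "inj_on g (regions D)"
  proof (rule inj_onI)
    fix x y assume "x \<in> regions D" "y \<in> regions D" and g: "g x = g y"
    then have "pick x \<in> darts D" "reg D (pick x) = x" "pick y \<in> darts D" "reg D (pick y) = y"
      using pick by (auto simp: regions_def)
    then show "x = y"
      using f(2) g unfolding redrawn_def g_def by metis
  qed
  ultimately show "relabelled D E"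
    using f unfolding relabelled_def redrawn_def by blast
qed

lemma image_mset_rel_cong:
  assumes "rel_mset R M N" and "\<And>v w. v \<in># M \<Longrightarrow> R v w \<Longrightarrow> g v = h w"
  shows "image_mset g M = image_mset h N"
proof -
  have "rel_mset (\<lambda>v w. g v = h w) M N"
    using assms by (rule multiset.rel_mono_strong)
  then show ?thesis
    by (simp add: multiset.rel_eq[symmetric] multiset.rel_map)
qed

lemma mset_ends_rotation:
  "w \<in> rotations (map_vertex h v) \<Longrightarrow> mset (ends w) = image_mset h (mset (ends v))"
  by (cases v) auto

lemma dart_mset_redrawn:
  assumes "redrawn f D E"
  shows "dart_mset E = image_mset (map_prod f id) (dart_mset D)"
proof -
  have "image_mset (\<lambda>v. image_mset (map_prod f id) (mset (ends v))) (verts D) =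
      image_mset (\<lambda>w. mset (ends w)) (verts E)"
    using assms unfolding redrawn_def by (auto intro!: image_mset_rel_cong simp: mset_ends_rotation)
  moreover have "(\<Sum>v\<in>#M. image_mset h (mset (ends v))) = image_mset h (\<Sum>v\<in>#M. mset (ends v))"
    for h :: "dart \<Rightarrow> dart" and M :: "dart vertex multiset"
    by (induction M) auto
  ultimately show ?thesis
    by (metis dart_mset_def)
qed

lemma redrawn_id: "redrawn id D E \<longleftrightarrow>
    rel_mset (\<lambda>v w. w \<in> rotations v) (verts D) (verts E) \<and>
    (\<forall>d\<in>darts D. \<forall>d'\<in>darts D. reg E d = reg E d' \<longleftrightarrow> reg D d = reg D d')"
  by (simp add: redrawn_def prod.map_id0 vertex.map_id)

lemma rel_mset_memD:
  assumes "rel_mset R M N"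
  shows "w \<in># N \<Longrightarrow> \<exists>v\<in>#M. R v w \<and> rel_mset R (M - {#v#}) (N - {#w#})"
    and "v \<in># M \<Longrightarrow> \<exists>w\<in>#N. R v w \<and> rel_mset R (M - {#v#}) (N - {#w#})"
proof -
  assume "w \<in># N"
  then obtain N' where "N = add_mset w N'"
    by (auto dest: multi_member_split)
  then show "\<exists>v\<in>#M. R v w \<and> rel_mset R (M - {#v#}) (N - {#w#})"
    using assms msed_rel_invR[of R M w N'] by auto
next
  assume "v \<in># M"
  then obtain M' where "M = add_mset v M'"
    by (auto dest: multi_member_split)
  then show "\<exists>w\<in>#N. R v w \<and> rel_mset R (M - {#v#}) (N - {#w#})"
    using assms msed_rel_invL[of R v M' N] by auto
qed

text \<open>
  Being a plane diagram depends only on the cyclic order at the vertices and on the partition of the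
  darts into regions; sets of regions of the two diagrams are translated into each other through the
  darts. It suffices to treat diagrams with the same edges, since relabelled diagrams
  are compared by \<open>isotopic\<close> only when both are known to be plane.
\<close>

lemma plane_diagram_redrawn:
  assumes D: "plane_diagram D" and DE: "redrawn id D E"
  shows "plane_diagram E"
proof -
  have vE: "\<exists>v\<in>#verts D. w \<in> rotations v" if "w \<in># verts E" for w
    using DE rel_mset_memD(1)[OF _ that] unfolding redrawn_id by blast
  have vD: "\<exists>w\<in>#verts E. w \<in> rotations v" if "v \<in># verts D" for v
    using DE rel_mset_memD(2)[OF _ that] unfolding redrawn_id by blast
  have dm: "dart_mset E = dart_mset D"
    using dart_mset_redrawn[OF DE] by (simp add: prod.map_id0)
  have darts: "darts E = darts D" and edges: "edges E = edges D"
    by (simp_all add: darts_def edges_def dm)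
  have same: "reg E d = reg E d' \<longleftrightarrow> reg D d = reg D d'" if "d \<in> darts D" "d' \<in> darts D" for d d'
    using DE that by (simp add: redrawn_id)
  have ends: "set (ends w) = set (ends v)" if "w \<in> rotations v" for v w :: "dart vertex"
    using mset_ends_rotation[of w id v] that by (auto simp: vertex.map_id dest: mset_eq_setD)
  have flip: "flip d \<in> darts D" if "d \<in> darts D" for d
    using D that by (rule plane_diagram_flip)
  have oriented: "\<forall>w\<in>#verts E. oriented w"
  proof
    fix w assume "w \<in># verts E"
    then obtain v where "v \<in># verts D" "w \<in> rotations v"
      using vE by blast
    then show "oriented w"
      using D by (cases v) (auto simp: plane_diagram_def)
  qed
  have "corners_at (reg E) w" if w: "w \<in># verts E" for w
  proof -
    obtain v where v: "v \<in># verts D" "w \<in> rotations v"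
      using vE[OF w] by blast
    have "corners_at (reg D) v"
      using D v by (auto simp: plane_diagram_def corners_match_iff)
    then have "corners_at (reg D) w"
      using v by (cases v) auto
    moreover have "set (ends w) \<subseteq> darts D"
      using w by (auto simp: darts[symmetric] darts_iff)
    ultimately show ?thesis
      by (cases w) (auto simp: same flip)
  qed
  then have corners: "corners_match E"
    by (simp add: corners_match_iff)
  define down where "down R = reg D ` {d \<in> darts D. reg E d \<in> R}" for R
  define up where "up R = reg E ` {d \<in> darts D. reg D d \<in> R}" for R
  have down: "reg D d \<in> down R \<longleftrightarrow> reg E d \<in> R" if "d \<in> darts D" for d R
  proof
    assume "reg D d \<in> down R"
    then obtain d' where "d' \<in> darts D" "reg E d' \<in> R" "reg D d = reg D d'"
      by (auto simp: down_def)
    then show "reg E d \<in> R"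
      using same[OF that] by metis
  qed (use that in \<open>auto simp: down_def\<close>)
  have up: "reg E d \<in> up R \<longleftrightarrow> reg D d \<in> R" if "d \<in> darts D" for d R
  proof
    assume "reg E d \<in> up R"
    then obtain d' where "d' \<in> darts D" "reg D d' \<in> R" "reg E d = reg E d'"
      by (auto simp: up_def)
    then show "reg D d \<in> R"
      using same[OF that] by metis
  qed (use that in \<open>auto simp: up_def\<close>)
  have "edge_boundary D (down R) = edge_boundary E R" for R
    using edge_in_both_directions[OF D] by (auto simp: edge_boundary_def edges down)
  moreover have "down R \<subseteq> regions D" for R
    by (auto simp: down_def regions_def)
  ultimately have down_cases: "down R = {} \<or> down R = regions D" if "edge_boundary E R = {}" for R
    using D that by (simp add: plane_diagram_def spherical_def)
  have "R = {} \<or> R = regions E" if R: "R \<subseteq> regions E" "edge_boundary E R = {}" for R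
    using down_cases[OF R(2)]
  proof
    assume "down R = {}"
    then have "reg E d \<notin> R" if "d \<in> darts D" for d
      using that down by blast
    then show ?thesis
      using R(1) by (auto simp: regions_def darts)
  next
    assume "down R = regions D"
    then have "reg E d \<in> R" if "d \<in> darts D" for d
      using that down[OF that, of R] by (simp add: regions_def)
    then show ?thesis
      using R(1) by (auto simp: regions_def darts)
  qed
  moreover have "\<exists>R\<subseteq>regions E. edge_boundary E R = Z" if Z: "mod2_cycle E Z" for Z
  proof -
    have "mod2_cycle D Z"
      unfolding mod2_cycle_def
    proof (intro conjI ballI)
      fix v assume "v \<in># verts D"
      then obtain w where w: "w \<in># verts E" "w \<in> rotations v"
        using vD by blast
      then have "even (card {d \<in> set (ends w). fst d \<in> Z})"
        using Z by (simp add: mod2_cycle_def)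
      then show "even (card {d \<in> set (ends v). fst d \<in> Z})"
        by (simp add: ends[OF w(2)])
    qed (use Z in \<open>simp add: mod2_cycle_def edges\<close>)
    then obtain R where R: "edge_boundary D R = Z"
      using D by (auto simp: plane_diagram_def spherical_def)
    have "edge_boundary E (up R) = Z"
      using edge_in_both_directions[OF D] by (auto simp: R[symmetric] edge_boundary_def edges up)
    moreover have "up R \<subseteq> regions E"
      by (auto simp: up_def regions_def darts)
    ultimately show ?thesis
      by blast
  qed
  ultimately have "spherical E"
    by (simp add: spherical_def)
  moreover have "verts E \<noteq> {#}"
    using D vD by (fastforce simp: plane_diagram_def)
  ultimately show ?thesis
    using D oriented corners unfolding plane_diagram_def dm darts by blast
qed

lemma isotopic_redrawn:
  assumes "plane_diagram D" "redrawn id D E"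
  shows "isotopic D E"
proof (rule isotopic.relabel)
  show "relabelled D E"
    unfolding relabelled_iff using assms(2) inj_on_id by blast
qed (use assms plane_diagram_redrawn in blast)+

lemma rotations_refl: "v \<in> rotations v"
  by (cases v) auto

lemma isotopic_refl: "plane_diagram D \<Longrightarrow> isotopic D D"
  by (rule isotopic_redrawn) (auto simp: redrawn_id rotations_refl intro!: multiset.rel_refl)

text \<open>
  The partition after a merge is symmetric in the two merged regions, although the names are not.
\<close>

lemma merge_eq_iff:
  "merge r r' f d = merge r r' f d' \<longleftrightarrow> f d = f d' \<or> {f d, f d'} \<subseteq> {r, r'}"
  by (auto simp: merge_def)

text \<open>
  The second conclusion is needed because rotating a marked vertex by a half turn exchanges the two
  new arcs, and with them the roles of the two merged regions.
\<close>

lemma redrawn_rejoin: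
  fixes f p q r s
  defines "h \<equiv> map_prod f id"
  assumes DE: "redrawn f D E"
    and v: "v \<in># verts D" "mset (ends v) = {#p, q, r, s#}" and w: "w \<in># verts E"
    and rest: "rel_mset (\<lambda>v w. w \<in> rotations (map_vertex (map_prod f id) v))
      (verts D - {#v#}) (verts E - {#w#})"
  shows "redrawn f (rejoin D {#v#} p q r s) (rejoin E {#w#} (h p) (h q) (h r) (h s))"
    "redrawn f (rejoin D {#v#} p q r s) (rejoin E {#w#} (h r) (h s) (h p) (h q))"
proof -
  let ?R = "\<lambda>v w. w \<in> rotations (map_vertex h v)"
  have same: "reg E (h d) = reg E (h d') \<longleftrightarrow> reg D d = reg D d'"
    if "d \<in> darts D" "d' \<in> darts D" for d d'
    using DE that by (simp add: redrawn_def h_def)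
  have "set (ends v) = {p, q, r, s}"
    using arg_cong[OF v(2), of set_mset] by simp
  then have qs: "q \<in> darts D" "s \<in> darts D"
    using v(1) by (auto simp: darts_iff)
  have dm: "darts (rejoin D {#v#} p q r s) = darts D"
    using v by (simp add: darts_def dart_mset_rejoin)
  have "rel_mset ?R (verts (rejoin D {#v#} p q r s))
      (verts (rejoin E {#w#} (h p) (h q) (h r) (h s)))"
    unfolding rejoin_def using rest by (auto intro!: rel_mset_Plus simp: h_def)
  moreover have "rel_mset ?R (verts (rejoin D {#v#} p q r s))
      (verts (rejoin E {#w#} (h r) (h s) (h p) (h q)))"
    unfolding rejoin_def using rest
    by (subst (2) add_mset_commute) (auto intro!: rel_mset_Plus simp: h_def)
  moreover have
    "reg (rejoin E {#w#} (h p) (h q) (h r) (h s)) (h d) =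
       reg (rejoin E {#w#} (h p) (h q) (h r) (h s)) (h d')
      \<longleftrightarrow> reg (rejoin D {#v#} p q r s) d = reg (rejoin D {#v#} p q r s) d'"
    "reg (rejoin E {#w#} (h r) (h s) (h p) (h q)) (h d) =
       reg (rejoin E {#w#} (h r) (h s) (h p) (h q)) (h d')
      \<longleftrightarrow> reg (rejoin D {#v#} p q r s) d = reg (rejoin D {#v#} p q r s) d'"
    if d: "d \<in> darts D" "d' \<in> darts D" for d d'
    using same[OF d(1) qs(1)] same[OF d(1) qs(2)] same[OF d(2) qs(1)] same[OF d(2) qs(2)]
      same[OF qs(1) qs(2)] same[OF d]
    by (auto simp: rejoin_def merge_eq_iff)
  ultimately show
    "redrawn f (rejoin D {#v#} p q r s) (rejoin E {#w#} (h p) (h q) (h r) (h s))"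
    "redrawn f (rejoin D {#v#} p q r s) (rejoin E {#w#} (h r) (h s) (h p) (h q))"
    unfolding redrawn_def dm h_def by blast+
qed

lemma redrawn_resolution:
  assumes DE: "redrawn f D E"
    and v: "v \<in># verts D" "is_marked v"
    and w: "w \<in># verts E" "w \<in> rotations (map_vertex (map_prod f id) v)"
    and rest: "rel_mset (\<lambda>v w. w \<in> rotations (map_vertex (map_prod f id) v))
      (verts D - {#v#}) (verts E - {#w#})"
  shows "redrawn f (resolution b D v) (resolution b E w)"
proof (cases v)
  case (Marked ne nw sw se)
  note rejoin = redrawn_rejoin[OF DE v(1) _ w(1) rest]
  show ?thesis
    using w(2) rejoin[of ne nw sw se] rejoin[of nw sw se ne]
    by (cases b) (auto simp: Marked positive_resolution_def negative_resolution_def)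
qed (use v in auto)


section \<open>Resolutions of a subdivided diagram\<close>

text \<open>
  Resolving at a marked vertex and inserting a point on an edge happen at different places and commute
  on the nose. The vertex itself may be renamed by the subdivision if \<open>e\<close> arrives at it.
\<close>

lemma resolution_subdivide:
  assumes "v \<in># verts D" "is_marked v" "e' \<notin> edges D"
  shows "resolution b (subdivide D e e') (map_vertex (id((e, False) := (e', False))) v) =
    subdivide (resolution b D v) e e'"
proof -
  let ?h = "id((e, False) := (e', False))"
  have "rejoin (subdivide D e e') {#map_vertex ?h v#} (?h p) (?h q) (?h r) (?h s) =
      subdivide (rejoin D {#v#} p q r s) e e'" if "{p, q, r, s} \<subseteq> darts D" for p q r s
  proof -
    have reg: "reg (subdivide D e e') (?h d) = reg D d" if "d \<in> darts D" for d
      using that assms(3) by (cases d) (auto simp: subdivide_def edges_iff)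
    have v': "map_vertex ?h v \<in># image_mset (map_vertex ?h) (verts D)"
      using assms(1) by simp
    have "image_mset (map_vertex ?h) (verts D - {#v#}) =
        image_mset (map_vertex ?h) (verts D) - {#map_vertex ?h v#}"
      using assms(1) by (simp add: image_mset_Diff)
    then have "verts (rejoin (subdivide D e e') {#map_vertex ?h v#} (?h p) (?h q) (?h r) (?h s)) =
        verts (subdivide (rejoin D {#v#} p q r s) e e')"
      using v' by (auto simp: rejoin_def subdivide_def simp del: fun_upd_apply dest!: multi_member_split)
    moreover have "reg (rejoin (subdivide D e e') {#map_vertex ?h v#} (?h p) (?h q) (?h r) (?h s)) =
        reg (subdivide (rejoin D {#v#} p q r s) e e')"
    proof -
      have "reg (rejoin (subdivide D e e') {#map_vertex ?h v#} (?h p) (?h q) (?h r) (?h s)) =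
          merge (reg D q) (reg D s) (reg (subdivide D e e'))"
        using that reg[of q] reg[of s] by (simp add: rejoin_def del: fun_upd_apply)
      then show ?thesis
        by (auto simp: fun_eq_iff subdivide_def rejoin_def merge_def)
    qed
    ultimately show ?thesis
      by simp
  qed
  note eq = this
  show ?thesis
  proof (cases v)
    case (Marked ne nw sw se)
    then have "{ne, nw, sw, se} \<subseteq> darts D"
      using assms(1) by (force simp: darts_iff)
    then show ?thesis
      using eq[of ne nw sw se] eq[of nw sw se ne]
      by (cases b) (simp_all add: Marked positive_resolution_def negative_resolution_def
          del: fun_upd_apply)
  qed (use assms in auto)
qed

section \<open>Isotopy invariance\<close>

lemma isotopic_plane_diagram: "isotopic D E \<Longrightarrow> plane_diagram D \<and> plane_diagram E"
  by (induction rule: isotopic.induct) auto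

text \<open>
  Quantities that are counted vertex by vertex are isotopy invariants as soon as they are blind to
  the names of the edges, to the starting point of the list of ends, and to ordinary points. The
  hypothesis \<open>oriented v\<close> matters for the sign of a crossing, which is read off from two of its ends.
\<close>

lemma sum_vertices_isotopic:
  fixes g :: "dart vertex \<Rightarrow> 'a :: comm_monoid_add"
  assumes "isotopic D E"
    and rot: "\<And>h v w. oriented v \<Longrightarrow> (\<And>d. snd (h d) = snd d) \<Longrightarrow>
      w \<in> rotations (map_vertex h v) \<Longrightarrow> g v = g w"
    and point: "\<And>p q. g (Point p q) = 0"
  shows "(\<Sum>v\<in>#verts D. g v) = (\<Sum>v\<in>#verts E. g v)"
  using assms(1)
proof (induction rule: isotopic.induct)
  case (relabel D E)
  then obtain f where "rel_mset (\<lambda>v w. w \<in> rotations (map_vertex (map_prod f id) v)) (verts D) (verts E)"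
    by (auto simp: relabelled_def)
  then have "image_mset g (verts D) = image_mset g (verts E)"
  proof (rule image_mset_rel_cong)
    fix v w
    assume "v \<in># verts D" "w \<in> rotations (map_vertex (map_prod f id) v)"
    then show "g v = g w"
      using relabel(1) by (intro rot[of v "map_prod f id"]) (auto simp: plane_diagram_def)
  qed
  then show ?case
    by simp
next
  case (subdivide D e e')
  let ?h = "id((e, False) := (e', False))"
  have "g (map_vertex ?h v) = g v" if "v \<in># verts D" for v
    using subdivide(1) that
    by (intro rot[of v ?h, symmetric]) (auto simp: plane_diagram_def rotations_refl)
  then have "image_mset (g \<circ> map_vertex ?h) (verts D) = image_mset g (verts D)"
    by (intro image_mset_cong) simp
  then show ?case
    by (simp add: subdivide_def image_mset.compositionality point)
qed auto

definition marked_count :: "diagram \<Rightarrow> nat" where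
  "marked_count D = (\<Sum>v\<in>#verts D. of_bool (is_marked v))"

lemma marked_count_eq_0_iff: "marked_count D = 0 \<longleftrightarrow> (\<forall>v\<in>#verts D. \<not> is_marked v)"
  by (auto simp: marked_count_def)

lemma marked_count_resolution:
  assumes "v \<in># verts D" "is_marked v"
  shows "marked_count D = Suc (marked_count (resolution b D v))"
  using assms
  by (cases v; cases b) (auto simp: marked_count_def positive_resolution_def
      negative_resolution_def rejoin_def dest!: multi_member_split)

lemma marked_count_isotopic: "isotopic D E \<Longrightarrow> marked_count D = marked_count E"
  unfolding marked_count_def
proof (rule sum_vertices_isotopic)
  fix h :: "dart \<Rightarrow> dart" and v w
  assume "w \<in> rotations (map_vertex h v)"
  then show "(of_bool (is_marked v) :: nat) = of_bool (is_marked w)"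
    by (cases v) auto
qed auto

lemma writhe_isotopic: "isotopic D E \<Longrightarrow> writhe D = writhe E"
  unfolding writhe_def
proof (rule sum_vertices_isotopic)
  fix h :: "dart \<Rightarrow> dart" and v w
  assume "oriented v" "\<And>d. snd (h d) = snd d" "w \<in> rotations (map_vertex h v)"
  then show "vertex_sign v = vertex_sign w"
    by (cases v) auto
qed auto

text \<open>
  Isotopic diagrams have corresponding marked vertices whose resolutions are again isotopic. Only the
  existence of a partner is recorded, in one direction; proving both directions together lets
  the induction pass through the symmetry rule of \<open>isotopic\<close>.
\<close>

definition resolutions_matched :: "diagram \<Rightarrow> diagram \<Rightarrow> bool" where
  "resolutions_matched D E \<longleftrightarrow> (\<forall>v\<in>#verts D. is_marked v \<longrightarrow>
     (\<exists>w\<in>#verts E. is_marked w \<and> (\<forall>b. isotopic (resolution b D v) (resolution b E w))))"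

lemma isotopic_relabelled_resolution:
  assumes "plane_diagram D" "plane_diagram E"
    and f: "inj_on f (edges D)" "redrawn f D E"
    and v: "v \<in># verts D" "is_marked v"
    and w: "w \<in># verts E" "w \<in> rotations (map_vertex (map_prod f id) v)"
    and rest: "rel_mset (\<lambda>v w. w \<in> rotations (map_vertex (map_prod f id) v))
      (verts D - {#v#}) (verts E - {#w#})"
  shows "is_marked w" "isotopic (resolution b D v) (resolution b E w)"
    "isotopic (resolution b E w) (resolution b D v)"
proof -
  show "is_marked w"
    using v(2) w(2) by (cases v) auto
  have "redrawn f (resolution b D v) (resolution b E w)"
    using f(2) v w rest by (rule redrawn_resolution)
  then have "relabelled (resolution b D v) (resolution b E w)"
    unfolding relabelled_iff using f(1) v(1) by (auto simp: edges_resolution)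
  then show "isotopic (resolution b D v) (resolution b E w)"
    using assms(1,2) v(1) w(1) by (intro isotopic.relabel plane_diagram_resolution)
  then show "isotopic (resolution b E w) (resolution b D v)"
    by (rule isotopic.sym)
qed

lemma resolutions_matched_isotopic:
  "isotopic D E \<Longrightarrow> resolutions_matched D E \<and> resolutions_matched E D"
proof (induction rule: isotopic.induct)
  case (relabel D E)
  then obtain f where f: "inj_on f (edges D)" "redrawn f D E"
    by (auto simp: relabelled_iff)
  note rel = f(2)[unfolded redrawn_def, THEN conjunct1]
  note iso = isotopic_relabelled_resolution[OF relabel(1,2) f]
  show ?case
    unfolding resolutions_matched_def
  proof (intro conjI ballI impI)
    fix v assume v: "v \<in># verts D" "is_marked v"
    show "\<exists>w\<in>#verts E. is_marked w \<and> (\<forall>b. isotopic (resolution b D v) (resolution b E w))"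
      using rel_mset_memD(2)[OF rel v(1)] iso[OF v] by blast
  next
    fix w assume w: "w \<in># verts E" "is_marked w"
    then obtain v where v: "v \<in># verts D" "w \<in> rotations (map_vertex (map_prod f id) v)"
      and rest: "rel_mset (\<lambda>v w. w \<in> rotations (map_vertex (map_prod f id) v))
        (verts D - {#v#}) (verts E - {#w#})"
      using rel_mset_memD(1)[OF rel w(1)] by blast
    then have "is_marked v"
      using w(2) by (cases v) auto
    then show "\<exists>v\<in>#verts D. is_marked v \<and> (\<forall>b. isotopic (resolution b E w) (resolution b D v))"
      using iso v w(1) rest by blast
  qed
next
  case (subdivide D e e')
  let ?h = "map_vertex (id((e, False) := (e', False)))"
  have marked: "is_marked (?h v) \<longleftrightarrow> is_marked v" for v
    by (cases v) auto
  have verts: "?h v \<in># verts (subdivide D e e')" if "v \<in># verts D" for v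
    using that by (simp add: subdivide_def)
  have iso: "isotopic (resolution b D v) (resolution b (subdivide D e e') (?h v))"
    if v: "v \<in># verts D" "is_marked v" for b v
  proof -
    have eq: "resolution b (subdivide D e e') (?h v) = subdivide (resolution b D v) e e'"
      using v subdivide(4) by (rule resolution_subdivide)
    then have "plane_diagram (subdivide (resolution b D v) e e')"
      using plane_diagram_resolution[OF subdivide(2) verts[OF v(1)]] by metis
    then show ?thesis
      unfolding eq using subdivide(1,3,4) v
      by (intro isotopic.subdivide plane_diagram_resolution) (simp_all add: edges_resolution)
  qed
  have "\<exists>v\<in>#verts D. w = ?h v" if "w \<in># verts (subdivide D e e')" "is_marked w" for w
    using that by (auto simp: subdivide_def)
  then show ?case
    unfolding resolutions_matched_def using iso isotopic.sym marked verts by metis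
next
  case (trans D E F)
  then show ?case
    unfolding resolutions_matched_def using isotopic.trans by meson
qed auto

lemma verts_resolution:
  assumes "w \<in># verts D" "w \<noteq> v"
  shows "w \<in># verts (resolution b D v)"
  using assms by (cases v; cases b)
    (auto simp: positive_resolution_def negative_resolution_def rejoin_def in_diff_count)

text \<open>
  Merging two pairs of regions one after the other yields the partition generated by both pairs, in
  either order. The second pair is looked up after the first merge, as in an iterated resolution.
\<close>

lemma merges_commute:
  fixes f :: "dart \<Rightarrow> nat" and q s q' s' :: dart
  defines "g \<equiv> merge (f q) (f s) f" and "h \<equiv> merge (f q') (f s') f"
  shows "merge (h q) (h s) h d = merge (h q) (h s) h d' \<longleftrightarrow>
    merge (g q') (g s') g d = merge (g q') (g s') g d'"
  unfolding g_def h_def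
  by (simp only: merge_eq_iff insert_subset empty_subsetI insert_iff empty_iff simp_thms)
    (smt (verit))

lemma resolutions_commute:
  assumes v: "v \<in># verts D" "is_marked v" and w: "w \<in># verts D" "is_marked w" and "v \<noteq> w"
  shows "redrawn id (resolution c (resolution b D v) w) (resolution b (resolution c D w) v)"
proof -
  obtain p q r s where D_v: "\<And>D. resolution b D v = rejoin D {#v#} p q r s"
    using resolution_eq_rejoin[OF v(2)] by metis
  obtain p' q' r' s' where D_w: "\<And>D. resolution c D w = rejoin D {#w#} p' q' r' s'"
    using resolution_eq_rejoin[OF w(2)] by metis
  obtain M where M: "verts D = add_mset v (add_mset w M)"
  proof -
    obtain N where N: "verts D = add_mset v N"
      using v(1) by (auto dest: multi_member_split)
    then obtain M where "N = add_mset w M"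
      using w(1) \<open>v \<noteq> w\<close> by (auto dest: multi_member_split)
    then show ?thesis
      using N that by simp
  qed
  have "verts (resolution c (resolution b D v) w) = verts (resolution b (resolution c D w) v)"
    unfolding D_v D_w rejoin_def by (simp add: M \<open>v \<noteq> w\<close>)
  moreover have "reg (resolution b (resolution c D w) v) d = reg (resolution b (resolution c D w) v) d'
      \<longleftrightarrow> reg (resolution c (resolution b D v) w) d = reg (resolution c (resolution b D v) w) d'"
    for d d'
    unfolding D_v D_w rejoin_def by (simp add: merges_commute)
  ultimately show ?thesis
    by (simp add: redrawn_id multiset.rel_refl rotations_refl)
qed


section \<open>The bracket of a marked graph diagram\<close>

lemma marked_value_resolve:
  assumes "v \<in># verts D" "is_marked v"
    and "marked_value br (resolution True D v) P" "marked_value br (resolution False D v) N"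
  shows "marked_value br D (var_x * P + var_y * N)"
  using assms by (cases v) (auto intro: marked_value.resolve)

lemma marked_value_cases:
  assumes "marked_value br D Q"
  obtains (unmarked) "\<forall>v\<in>#verts D. \<not> is_marked v" "Q = const_axy (br D)"
  | (resolve) v P N where "v \<in># verts D" "is_marked v"
    "marked_value br (resolution True D v) P" "marked_value br (resolution False D v) N"
    "Q = var_x * P + var_y * N"
  using assms
proof cases
  case (resolve ne nw sw se P N)
  then show ?thesis
    using that(2)[of "Marked ne nw sw se" P N] by simp
qed (use that(1) in blast)

lemma marked_value_exists: "\<exists>P. marked_value br D P"
proof (induction "marked_count D" arbitrary: D)
  case 0
  then show ?case
    by (metis marked_count_eq_0_iff marked_value.unmarked)
next
  case (Suc k)
  then obtain v where v: "v \<in># verts D" "is_marked v"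
    by (metis marked_count_eq_0_iff nat.distinct(1))
  then have "\<exists>P. marked_value br (resolution b D v) P" for b
    using Suc marked_count_resolution[OF v, of b] by simp
  then show ?case
    using marked_value_resolve[OF v] by metis
qed

text \<open>
  The value of a diagram depends neither on the order in which the marked vertices are resolved nor
  on the diagram within its isotopy class. Let the first computation start at \<open>v\<close> and the second one
  at the vertex corresponding to \<open>u\<close>. If \<open>u = v\<close>, the resolutions are isotopic and have fewer marked
  vertices. Otherwise both values are compared with the one that is obtained by resolving at \<open>u\<close>
  and \<open>v\<close>, where the order is irrelevant by \<open>resolutions_commute\<close>.
\<close>

lemma marked_value_unique:
  assumes br: "isotopy_invariant br"
    and "isotopic D E" "marked_value br D P" "marked_value br E Q"
  shows "P = Q"
  using assms(2-4)
proof (induction "marked_count D" arbitrary: D E P Q rule: less_induct)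
  case less
  show ?case
  proof (cases "marked_count D")
    case 0
    then have "marked_count E = 0"
      using less.prems(1) marked_count_isotopic by simp
    then have unmarked: "\<forall>v\<in>#verts D. \<not> is_marked v" "\<forall>v\<in>#verts E. \<not> is_marked v"
      using 0 by (simp_all add: marked_count_eq_0_iff)
    then have "P = const_axy (br D)" "Q = const_axy (br E)"
      using less.prems by (auto elim: marked_value_cases)
    moreover have "br D = br E"
      using br unmarked less.prems(1) isotopic_plane_diagram[of D E]
      by (auto simp: isotopy_invariant_def trivalent_graph_diagram_def)
    ultimately show ?thesis
      by simp
  next
    case (Suc k)
    have D: "plane_diagram D"
      using less.prems(1) isotopic_plane_diagram by blast
    have "marked_count E = Suc k"
      using Suc less.prems(1) marked_count_isotopic by simp
    then have not_unmarked: "\<not> (\<forall>v\<in>#verts D. \<not> is_marked v)" "\<not> (\<forall>v\<in>#verts E. \<not> is_marked v)"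
      using Suc by (simp_all add: marked_count_eq_0_iff[symmetric])
    obtain v P1 P2 where v: "v \<in># verts D" "is_marked v" and
      P: "marked_value br (resolution True D v) P1" "marked_value br (resolution False D v) P2"
        "P = var_x * P1 + var_y * P2"
      using not_unmarked(1) less.prems(2) by (blast elim: marked_value_cases)
    obtain w Q1 Q2 where w: "w \<in># verts E" "is_marked w" and
      Q: "marked_value br (resolution True E w) Q1" "marked_value br (resolution False E w) Q2"
        "Q = var_x * Q1 + var_y * Q2"
      using not_unmarked(2) less.prems(3) by (blast elim: marked_value_cases)
    obtain u where u: "u \<in># verts D" "is_marked u"
      and uw: "\<And>b. isotopic (resolution b D u) (resolution b E w)"
      using resolutions_matched_isotopic[OF less.prems(1)] w isotopic.sym
      unfolding resolutions_matched_def by metis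
    have smaller: "marked_count (resolution b D z) < marked_count D"
      if "z \<in># verts D" "is_marked z" for b z
      using marked_count_resolution[OF that, of b] by simp
    have IH_refl: "P = Q" if "z \<in># verts D" "is_marked z"
      "marked_value br (resolution b D z) P" "marked_value br (resolution b D z) Q" for b z P Q
      using less.hyps isotopic_refl[OF plane_diagram_resolution[OF D that(1)]] smaller[OF that(1,2)]
        that(3,4) by blast
    show ?thesis
    proof (cases "u = v")
      case True
      then have "P1 = Q1" "P2 = Q2"
        using less.hyps[OF smaller[OF u] uw] True P Q by blast+
      then show ?thesis
        by (simp add: P(3) Q(3))
    next
      case False
      have u': "u \<in># verts (resolution b D v)" for b
        using u False by (simp add: verts_resolution)
      have v': "v \<in># verts (resolution b D u)" for b
        using v False by (simp add: verts_resolution)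
      \<comment> \<open>\<open>V b c\<close> is the value after resolving \<open>v\<close> with sign \<open>b\<close> and \<open>u\<close> with sign \<open>c\<close>.\<close>
      define V where "V b c = (SOME P. marked_value br (resolution c (resolution b D v) u) P)" for b c
      have V: "marked_value br (resolution c (resolution b D v) u) (V b c)" for b c
        unfolding V_def by (rule someI_ex[OF marked_value_exists])
      have V': "marked_value br (resolution b (resolution c D u) v) (V b c)" for b c
      proof -
        obtain W where W: "marked_value br (resolution b (resolution c D u) v) W"
          using marked_value_exists by blast
        have plane: "plane_diagram (resolution c (resolution b D v) u)"
          using D v u' by (intro plane_diagram_resolution)
        have red: "redrawn id (resolution c (resolution b D v) u) (resolution b (resolution c D u) v)"
          using v u False by (intro resolutions_commute) auto
        have "marked_count (resolution c (resolution b D v) u) < marked_count D"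
          using marked_count_resolution[OF v, of b] marked_count_resolution[OF u' u(2), of b c] by simp
        then have "V b c = W"
          using less.hyps isotopic_redrawn[OF plane red] V W by blast
        then show ?thesis
          using W by simp
      qed
      have "P1 = var_x * V True True + var_y * V True False"
        "P2 = var_x * V False True + var_y * V False False"
        using IH_refl[OF v] P marked_value_resolve[OF u' u(2) V V] by blast+
      moreover have "Q1 = var_x * V True True + var_y * V False True"
        "Q2 = var_x * V True False + var_y * V False False"
        using less.hyps[OF smaller[OF u] uw marked_value_resolve[OF v' v(2) V' V']] Q by metis+
      ultimately show ?thesis
        by (simp add: P(3) Q(3) algebra_simps)
    qed
  qed
qed

lemma marked_bracket_eqI:
  assumes "isotopy_invariant br" "plane_diagram D" "marked_value br D P"
  shows "marked_bracket br D = P"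
  unfolding marked_bracket_def
  using assms marked_value_unique[OF assms(1) isotopic_refl] by blast

lemma marked_value_marked_bracket:
  assumes "isotopy_invariant br" "plane_diagram D"
  shows "marked_value br D (marked_bracket br D)"
  using marked_bracket_eqI[OF assms] marked_value_exists by metis

lemma marked_bracket_isotopic:
  assumes "isotopy_invariant br" "isotopic D E"
  shows "marked_bracket br D = marked_bracket br E"
  using marked_value_unique[OF assms] marked_value_marked_bracket[OF assms(1)]
    isotopic_plane_diagram[OF assms(2)] by blast

lemma marked_bracket_resolve:
  assumes "isotopy_invariant br" "plane_diagram D" "v \<in># verts D" "is_marked v"
  shows "marked_bracket br D =
    var_x * marked_bracket br (resolution True D v) + var_y * marked_bracket br (resolution False D v)"
proof -
  have "marked_value br (resolution b D v) (marked_bracket br (resolution b D v))" for b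
    using assms(1) plane_diagram_resolution[OF assms(2,3)] by (rule marked_value_marked_bracket)
  then show ?thesis
    by (intro marked_bracket_eqI[OF assms(1,2)] marked_value_resolve[OF assms(3,4)])
qed

lemma const_axy_mult: "const_axy (c * d) = const_axy c * const_axy d"
  by (simp add: const_axy_def)

text \<open>
  A new circle shares no vertex with the rest of the diagram, and the disk it bounds, having a fresh
  name, is not affected by merging.
\<close>

lemma resolution_add_circle:
  assumes "v \<in># verts D" "d \<in> darts D" "e \<notin> edges D" "n \<notin> regions D"
  shows "resolution b (add_circle D d e c n) v = add_circle (resolution b D v) d e c n"
proof -
  have "rejoin (add_circle D d e c n) {#v#} p q r s = add_circle (rejoin D {#v#} p q r s) d e c n"
    if qs: "q \<in> darts D" "s \<in> darts D" for p q r s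
  proof -
    have "n \<noteq> reg D s"
      using qs assms(4) by (auto simp: regions_def)
    moreover have "fst q \<noteq> e" "fst s \<noteq> e"
      using qs assms(3) by (auto simp: edges_def)
    then have "q \<noteq> (e, x)" "s \<noteq> (e, x)" for x
      by auto
    ultimately have "merge (reg (add_circle D d e c n) q) (reg (add_circle D d e c n) s)
        (reg (add_circle D d e c n)) x = reg (add_circle (rejoin D {#v#} p q r s) d e c n) x" for x
      by (simp add: add_circle_def rejoin_def merge_def)
    moreover have "add_mset u (verts D) - {#v#} = add_mset u (verts D - {#v#})" for u
      using assms(1) by (auto dest!: multi_member_split)
    ultimately show ?thesis
      by (simp add: fun_eq_iff rejoin_def add_circle_def)
  qed
  note eq = this
  show ?thesis
  proof (cases v)
    case (Marked ne nw sw se)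
    then have "set [ne, nw, sw, se] \<subseteq> darts D"
      using assms(1) by (force simp: darts_iff)
    then show ?thesis
      using eq[of nw se ne sw] eq[of sw ne nw se]
      by (cases b) (simp_all add: Marked positive_resolution_def negative_resolution_def)
  qed auto
qed

text \<open>
  The relation for circles extends from the bracket to diagrams with marked vertices, because every
  computation for \<open>D\<close> can be carried out in the presence of the circle.
\<close>

lemma marked_value_add_circle:
  assumes br: "circle_relation br"
    and "marked_value br D P" "plane_diagram D" "d \<in> darts D" "e \<notin> edges D" "n \<notin> regions D"
  shows "marked_value br (add_circle D d e b n) (const_axy (a_pow (-6) + 1 + a_pow 6) * P)"
  using assms(2-)
proof (induction rule: marked_value.induct)
  case (unmarked D)
  then have "br (add_circle D d e b n) = (a_pow (-6) + 1 + a_pow 6) * br D"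
    using br unfolding circle_relation_def trivalent_graph_diagram_def by blast
  moreover have "marked_value br (add_circle D d e b n) (const_axy (br (add_circle D d e b n)))"
    using unmarked(1) by (intro marked_value.unmarked) (auto simp: add_circle_def)
  ultimately show ?case
    by (simp add: const_axy_mult)
next
  case (resolve ne nw sw se D P N)
  let ?v = "Marked ne nw sw se"
  have regions: "regions (resolution c D ?v) \<subseteq> regions D" for c
  proof -
    have "set [ne, nw, sw, se] \<subseteq> darts D"
      using resolve(1) by (force simp: darts_iff)
    then show ?thesis
      using darts_resolution[OF resolve(1), of c]
      by (auto simp: regions_def positive_resolution_def negative_resolution_def rejoin_def merge_def)
  qed
  have add_circle: "add_circle (resolution c D ?v) d e b n = resolution c (add_circle D d e b n) ?v"
    for c
    using resolve by (intro resolution_add_circle[symmetric])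
  have "marked_value br (add_circle (resolution True D ?v) d e b n)
      (const_axy (a_pow (-6) + 1 + a_pow 6) * P)"
    using resolve regions[of True] plane_diagram_resolution[of D ?v True]
      darts_resolution[OF resolve(1), of True] edges_resolution[OF resolve(1), of True] by auto
  moreover have "marked_value br (add_circle (resolution False D ?v) d e b n)
      (const_axy (a_pow (-6) + 1 + a_pow 6) * N)"
    using resolve regions[of False] plane_diagram_resolution[of D ?v False]
      darts_resolution[OF resolve(1), of False] edges_resolution[OF resolve(1), of False] by auto
  moreover have in_add_circle: "?v \<in># verts (add_circle D d e b n)"
    using resolve(1) by (simp add: add_circle_def)
  ultimately have "marked_value br (add_circle D d e b n)
      (var_x * (const_axy (a_pow (-6) + 1 + a_pow 6) * P) +
       var_y * (const_axy (a_pow (-6) + 1 + a_pow 6) * N))"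
    unfolding add_circle by (intro marked_value_resolve[of ?v] is_marked.simps(1)[THEN iffD2] TrueI)
  then show ?case
    by (simp add: algebra_simps)
qed

lemma marked_bracket_add_circle:
  assumes "isotopy_invariant br" "circle_relation br" "plane_diagram D"
    "plane_diagram (add_circle D d e b n)" "d \<in> darts D" "e \<notin> edges D" "n \<notin> regions D"
  shows "marked_bracket br (add_circle D d e b n) =
    const_axy (a_pow (-6) + 1 + a_pow 6) * marked_bracket br D"
  using assms
  by (intro marked_bracket_eqI marked_value_add_circle marked_value_marked_bracket)


section \<open>The resolutions of a marked curl\<close>

text \<open>
  The arc that remains of a marked curl once its loop has been straightened: the point is replaced by
  two points with the edge \<open>l\<close> of the former loop between them.
\<close>

definition split_point :: "diagram \<Rightarrow> dart \<Rightarrow> dart \<Rightarrow> nat \<Rightarrow> diagram" where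
  "split_point D p q l =
     \<lparr>verts = verts D - {#Point p q#} + {#Point p (l, \<not> snd p), Point (l, snd p) q#},
      reg = (reg D)((l, snd p) := reg D p, (l, \<not> snd p) := reg D q)\<rparr>"

text \<open>
  Which of the two edges at the point has to be subdivided depends on the direction of the arc, as
  \<open>subdivide\<close> gives the new name to the part behind the inserted point.
\<close>

lemma isotopic_split_point:
  assumes D: "plane_diagram D" and v: "Point p q \<in># verts D" and l: "l \<notin> edges D"
    and plane: "plane_diagram (split_point D p q l)"
  shows "isotopic D (split_point D p q l)"
proof -
  \<comment> \<open>\<open>a\<close> is the edge that arrives at the point.\<close>
  define a where "a = (if snd p then fst q else fst p)"
  obtain M where M: "verts D = add_mset (Point p q) M"
    using v by (auto dest: multi_member_split)
  have "oriented (Point p q)" and corners: "corners_at (reg D) (Point p q)"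
    using D v by (auto simp: plane_diagram_def corners_match_iff)
  then have pq: "snd q = (\<not> snd p)"
    by auto
  have pD: "p \<in> darts D" "q \<in> darts D"
    using v by (force simp: darts_iff)+
  then have a: "a \<in> edges D" "a \<noteq> l"
    using l by (auto simp: a_def edges_def)
  have a_dart: "(a, False) = (if snd p then q else p)"
    using pq by (auto simp: a_def prod_eq_iff)
  let ?h = "id((a, False) := (l, False))"
  have "map_vertex ?h v = v" if "v \<in># M" for v
  proof -
    have "(a, False) \<notin> set (ends v)"
    proof
      assume "(a, False) \<in> set (ends v)"
      then have "2 \<le> count (dart_mset D) (a, False)"
        using that by (auto simp: dart_mset_def M a_dart count_eq_zero_iff dest!: multi_member_split
            split: if_splits)
      moreover have "count (dart_mset D) (a, False) \<le> 1"
        using D unfolding plane_diagram_def by blast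
      ultimately show False
        by simp
    qed
    then show ?thesis
      by (cases v) auto
  qed
  then have "image_mset (map_vertex ?h) M = M"
    by (metis (no_types, lifting) image_mset_cong multiset.map_ident)
  then have "verts (subdivide D a l) =
      M + {#map_vertex ?h (Point p q), Point (a, False) (l, True)#}"
    by (simp add: subdivide_def M)
  moreover have "{#map_vertex ?h (Point p q), Point (a, False) (l, True)#} =
      {#Point p (l, \<not> snd p), if snd p then Point q (l, snd p) else Point (l, snd p) q#}"
    using a_dart pq by (cases "snd p") auto
  ultimately have "verts (subdivide D a l) =
      M + {#Point p (l, \<not> snd p), if snd p then Point q (l, snd p) else Point (l, snd p) q#}"
    by (simp only:)
  moreover have "verts (split_point D p q l) = M + {#Point p (l, \<not> snd p), Point (l, snd p) q#}"
    by (simp add: split_point_def M)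
  ultimately have verts: "rel_mset (\<lambda>v w. w \<in> rotations v) (verts (split_point D p q l))
      (verts (subdivide D a l))"
    by (auto intro!: rel_mset_Plus multiset.rel_refl simp: rotations_refl)
  have "reg (subdivide D a l) = reg (split_point D p q l)"
  proof -
    have "reg D (a, False) = (if snd p then reg D q else reg D p)"
      "reg D (a, True) = (if snd p then reg D p else reg D q)"
      using corners a_dart by (cases "snd p"; simp add: flip_def; metis fst_conv snd_conv)+
    then have "reg (subdivide D a l) d = reg (split_point D p q l) d" for d
      by (cases d; cases "fst d = l"; cases "snd d"; cases "snd p")
        (simp_all add: subdivide_def split_point_def)
    then show ?thesis
      by (simp add: fun_eq_iff)
  qed
  then have red: "redrawn id (split_point D p q l) (subdivide D a l)"
    using verts by (simp add: redrawn_id)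
  have "isotopic D (subdivide D a l)"
    using D plane_diagram_redrawn[OF plane red] a(1) l by (intro isotopic.subdivide)
  then show ?thesis
    using isotopic_redrawn[OF plane red] isotopic.sym isotopic.trans by blast
qed

text \<open>
  Joining the north ends with each other closes the loop to a circle, which is placed in the region
  containing both ends of the marker, so nothing is merged. The other resolution opens the
  disk \<open>n\<close> to the opposite region and straightens the arc.
\<close>

lemma curl6_resolutions:
  assumes D: "plane_diagram D" and "curl6 D E" and E: "plane_diagram E"
  obtains v d l b n where "v \<in># verts E" "is_marked v" "d \<in> darts D" "l \<notin> edges D" "n \<notin> regions D"
    "isotopic (resolution True E v) (add_circle D d l b n)"
    "isotopic (resolution False E v) D"
  using assms(2)
proof cases
  case (1 p q l n)
  let ?v = "Marked (l, snd p) (l, \<not> snd p) p q"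
  have v: "?v \<in># verts E"
    by (simp add: 1(1))
  have plane: "plane_diagram (resolution b E ?v)" for b
    using E v by (rule plane_diagram_resolution)
  obtain M where M: "verts D = add_mset (Point p q) M"
    using 1(2) by (auto dest: multi_member_split)
  have pq: "p \<in> darts D" "q \<in> darts D"
    using 1(2) by (force simp: darts_iff)+
  have not_l: "fst d \<noteq> l \<and> reg D d \<noteq> n" if "d \<in> darts D" for d
    using 1(3,4) that by (auto simp: edges_def regions_def)
  have neq: "p \<noteq> (l, x)" "q \<noteq> (l, x)" for x
    using not_l[OF pq(1)] not_l[OF pq(2)] by auto
  have darts: "d \<in> darts D \<or> fst d = l" if "d \<in> darts (resolution False E ?v)" for d
    using that pq by (auto simp: darts_iff 1(1) M negative_resolution_def rejoin_def)
  show ?thesis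
  proof (rule that[of ?v q l n "snd p"])
    have "redrawn id (resolution True E ?v) (add_circle D q l (snd p) n)"
      unfolding redrawn_id
    proof (intro conjI ballI)
      show "rel_mset (\<lambda>v w. w \<in> rotations v) (verts (resolution True E ?v))
          (verts (add_circle D q l (snd p) n))"
        by (auto simp: positive_resolution_def rejoin_def add_circle_def 1(1) M
            multiset.rel_refl rotations_refl intro!: rel_mset_Plus)
      show "reg (add_circle D q l (snd p) n) d = reg (add_circle D q l (snd p) n) d' \<longleftrightarrow>
          reg (resolution True E ?v) d = reg (resolution True E ?v) d'" for d d'
        using not_l[OF pq(2)] neq
        by (simp add: positive_resolution_def rejoin_def add_circle_def 1(1) merge_def)
    qed
    then show "isotopic (resolution True E ?v) (add_circle D q l (snd p) n)"
      using plane by (rule isotopic_redrawn[rotated])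
    have red: "redrawn id (resolution False E ?v) (split_point D p q l)"
      unfolding redrawn_id
    proof (intro conjI ballI)
      show "rel_mset (\<lambda>v w. w \<in> rotations v) (verts (resolution False E ?v))
          (verts (split_point D p q l))"
        by (auto simp: negative_resolution_def rejoin_def split_point_def 1(1) M
            multiset.rel_refl rotations_refl intro!: rel_mset_Plus)
      show "reg (split_point D p q l) d = reg (split_point D p q l) d' \<longleftrightarrow>
          reg (resolution False E ?v) d = reg (resolution False E ?v) d'"
        if "d \<in> darts (resolution False E ?v)" "d' \<in> darts (resolution False E ?v)" for d d'
      proof -
        have "reg (resolution False E ?v) c = reg (split_point D p q l) c"
          if "c \<in> darts (resolution False E ?v)" for c
          using darts[OF that] not_l[of c] not_l[OF pq(1)] not_l[OF pq(2)] neq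
          by (cases c) (auto simp: negative_resolution_def rejoin_def split_point_def 1(1) merge_def)
        then show ?thesis
          using that by simp
      qed
    qed
    show "isotopic (resolution False E ?v) D"
      using isotopic_redrawn[OF plane red]
        isotopic_split_point[OF D 1(2,3) plane_diagram_redrawn[OF plane red]]
        isotopic.sym isotopic.trans by blast
  qed (use v pq 1 in auto)
qed

text \<open>
  As for \<open>curl6_resolutions\<close> with the two signs exchanged, since the loop now joins the west ends.
  Here the name \<open>n\<close> of the disk is the one that survives the merge, so the straightened diagram has
  the regions of \<open>D\<close> only up to renaming.
\<close>

lemma curl6'_resolutions:
  assumes D: "plane_diagram D" and "curl6' D E" and E: "plane_diagram E"
  obtains v d l b n where "v \<in># verts E" "is_marked v" "d \<in> darts D" "l \<notin> edges D" "n \<notin> regions D"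
    "isotopic (resolution True E v) D"
    "isotopic (resolution False E v) (add_circle D d l b n)"
  using assms(2)
proof cases
  case (1 p q l n)
  let ?v = "Marked p (l, \<not> snd p) (l, snd p) q"
  have v: "?v \<in># verts E"
    by (simp add: 1(1))
  have plane: "plane_diagram (resolution b E ?v)" for b
    using E v by (rule plane_diagram_resolution)
  obtain M where M: "verts D = add_mset (Point p q) M"
    using 1(2) by (auto dest: multi_member_split)
  have pq: "p \<in> darts D" "q \<in> darts D"
    using 1(2) by (force simp: darts_iff)+
  have not_l: "fst d \<noteq> l \<and> reg D d \<noteq> n" if "d \<in> darts D" for d
    using 1(3,4) that by (auto simp: edges_def regions_def)
  have neq: "p \<noteq> (l, x)" "q \<noteq> (l, x)" for x
    using not_l[OF pq(1)] not_l[OF pq(2)] by auto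
  have darts: "d \<in> darts D \<or> fst d = l" if "d \<in> darts (resolution True E ?v)" for d
    using that pq by (auto simp: darts_iff 1(1) M positive_resolution_def rejoin_def)
  show ?thesis
  proof (rule that[of ?v p l n "\<not> snd p"])
    have "redrawn id (resolution False E ?v) (add_circle D p l (\<not> snd p) n)"
      unfolding redrawn_id
    proof (intro conjI ballI)
      show "rel_mset (\<lambda>v w. w \<in> rotations v) (verts (resolution False E ?v))
          (verts (add_circle D p l (\<not> snd p) n))"
        by (auto simp: negative_resolution_def rejoin_def add_circle_def 1(1) M
            multiset.rel_refl rotations_refl intro!: rel_mset_Plus)
      show "reg (add_circle D p l (\<not> snd p) n) d = reg (add_circle D p l (\<not> snd p) n) d' \<longleftrightarrow>
          reg (resolution False E ?v) d = reg (resolution False E ?v) d'" for d d'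
        using not_l[OF pq(1)] neq
        by (simp add: negative_resolution_def rejoin_def add_circle_def 1(1) merge_def)
    qed
    then show "isotopic (resolution False E ?v) (add_circle D p l (\<not> snd p) n)"
      using plane by (rule isotopic_redrawn[rotated])
    have red: "redrawn id (resolution True E ?v) (split_point D p q l)"
      unfolding redrawn_id
    proof (intro conjI ballI)
      show "rel_mset (\<lambda>v w. w \<in> rotations v) (verts (resolution True E ?v))
          (verts (split_point D p q l))"
        by (auto simp: positive_resolution_def rejoin_def split_point_def 1(1) M
            multiset.rel_refl rotations_refl)
      show "reg (split_point D p q l) d = reg (split_point D p q l) d' \<longleftrightarrow>
          reg (resolution True E ?v) d = reg (resolution True E ?v) d'"
        if "d \<in> darts (resolution True E ?v)" "d' \<in> darts (resolution True E ?v)" for d d'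
      proof -
        \<comment> \<open>\<open>f\<close> describes the regions of the curl; the regions \<open>n\<close> and \<open>reg D q\<close> are merged.\<close>
        define f where "f c = (if c = (l, snd p) then reg D p
          else if c = (l, \<not> snd p) then n else reg D c)" for c
        have G: "reg (resolution True E ?v) = merge n (reg D q) f"
          using neq by (auto simp: positive_resolution_def rejoin_def 1(1) f_def fun_eq_iff merge_def)
        have S: "reg (split_point D p q l) c = (if f c = n then reg D q else f c)"
          if "c \<in> darts (resolution True E ?v)" for c
          using darts[OF that] not_l[of c] not_l[OF pq(1)] by (cases c) (auto simp: split_point_def f_def)
        show ?thesis
          unfolding G merge_eq_iff S[OF that(1)] S[OF that(2)] by auto
      qed
    qed
    show "isotopic (resolution True E ?v) D"
      using isotopic_redrawn[OF plane red]
        isotopic_split_point[OF D 1(2,3) plane_diagram_redrawn[OF plane red]]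
        isotopic.sym isotopic.trans by blast
  qed (use v pq 1 in auto)
qed

section \<open>The effect of a marked curl\<close>

lemma writhe_curl6: "curl6 D E \<Longrightarrow> writhe E = writhe D"
  by (auto simp: curl6.simps writhe_def dest!: multi_member_split)

lemma writhe_curl6': "curl6' D E \<Longrightarrow> writhe E = writhe D"
  by (auto simp: curl6'.simps writhe_def dest!: multi_member_split)

lemma marked_bracket_curl6:
  assumes "A2_bracket br" "plane_diagram D" "curl6 D E" "plane_diagram E"
  shows "marked_bracket br E =
    (const_axy (a_pow (-6) + 1 + a_pow 6) * var_x + var_y) * marked_bracket br D"
proof -
  have br: "isotopy_invariant br" "circle_relation br"
    using assms(1) by (auto simp: A2_bracket_def)
  obtain v d l b n where v: "v \<in># verts E" "is_marked v"
    and fresh: "d \<in> darts D" "l \<notin> edges D" "n \<notin> regions D"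
    and res: "isotopic (resolution True E v) (add_circle D d l b n)"
      "isotopic (resolution False E v) D"
    using curl6_resolutions[OF assms(2-4)] .
  have "marked_bracket br E = var_x * marked_bracket br (add_circle D d l b n) + var_y * marked_bracket br D"
    using marked_bracket_resolve[OF br(1) assms(4) v] res[THEN marked_bracket_isotopic[OF br(1)]]
    by simp
  also have "marked_bracket br (add_circle D d l b n) =
      const_axy (a_pow (-6) + 1 + a_pow 6) * marked_bracket br D"
    using br assms(2) isotopic_plane_diagram[OF res(1)] fresh by (intro marked_bracket_add_circle) auto
  finally show ?thesis
    by (simp add: algebra_simps)
qed

lemma marked_bracket_curl6':
  assumes "A2_bracket br" "plane_diagram D" "curl6' D E" "plane_diagram E"
  shows "marked_bracket br E =
    (var_x + const_axy (a_pow (-6) + 1 + a_pow 6) * var_y) * marked_bracket br D"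
proof -
  have br: "isotopy_invariant br" "circle_relation br"
    using assms(1) by (auto simp: A2_bracket_def)
  obtain v d l b n where v: "v \<in># verts E" "is_marked v"
    and fresh: "d \<in> darts D" "l \<notin> edges D" "n \<notin> regions D"
    and res: "isotopic (resolution True E v) D"
      "isotopic (resolution False E v) (add_circle D d l b n)"
    using curl6'_resolutions[OF assms(2-4)] .
  have "marked_bracket br E = var_x * marked_bracket br D + var_y * marked_bracket br (add_circle D d l b n)"
    using marked_bracket_resolve[OF br(1) assms(4) v] res[THEN marked_bracket_isotopic[OF br(1)]]
    by simp
  also have "marked_bracket br (add_circle D d l b n) =
      const_axy (a_pow (-6) + 1 + a_pow 6) * marked_bracket br D"
    using br assms(2) isotopic_plane_diagram[OF res(2)] fresh by (intro marked_bracket_add_circle) auto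
  finally show ?thesis
    by (simp add: algebra_simps)
qed

text \<open>
  The writhe is unchanged since a marked curl has no crossings; the rest is the skein relation at the
  curl.
\<close>

theorem proposition5p1:
  fixes br :: "diagram \<Rightarrow> laurent" and D0 :: diagram
  assumes "A2_bracket br"
    and "marked_graph_diagram D0"
  shows "(\<forall>D. Gamma6 D0 D \<longrightarrow>
            marked_polynomial br D =
              (const_axy (a_pow (-6) + 1 + a_pow 6) * var_x + var_y) * marked_polynomial br D0) \<and>
         (\<forall>D. Gamma6' D0 D \<longrightarrow>
            marked_polynomial br D =
              (var_x + const_axy (a_pow (-6) + 1 + a_pow 6) * var_y) * marked_polynomial br D0)"
proof (intro conjI allI impI)
  have br: "isotopy_invariant br"
    using assms(1) by (simp add: A2_bracket_def)
  have invariant: "marked_polynomial br D = marked_polynomial br E" if "isotopic D E" for D E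
    using marked_bracket_isotopic[OF br that] writhe_isotopic[OF that]
    by (simp add: marked_polynomial_def)
  fix D
  show "marked_polynomial br D =
      (const_axy (a_pow (-6) + 1 + a_pow 6) * var_x + var_y) * marked_polynomial br D0"
    if moved: "Gamma6 D0 D"
  proof -
    obtain E0 E where E: "isotopic D0 E0" "curl6 E0 E" "isotopic E D"
      using moved unfolding Gamma6_def by blast
    then have "plane_diagram E0" "plane_diagram E"
      using isotopic_plane_diagram by blast+
    then show ?thesis
      using marked_bracket_curl6[OF assms(1) _ E(2)] writhe_curl6[OF E(2)]
        invariant[OF E(1)] invariant[OF E(3)]
      by (simp add: marked_polynomial_def mult_ac)
  qed
  show "marked_polynomial br D =
      (var_x + const_axy (a_pow (-6) + 1 + a_pow 6) * var_y) * marked_polynomial br D0"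
    if moved: "Gamma6' D0 D"
  proof -
    obtain E0 E where E: "isotopic D0 E0" "curl6' E0 E" "isotopic E D"
      using moved unfolding Gamma6'_def by blast
    then have "plane_diagram E0" "plane_diagram E"
      using isotopic_plane_diagram by blast+
    then show ?thesis
      using marked_bracket_curl6'[OF assms(1) _ E(2)] writhe_curl6'[OF E(2)]
        invariant[OF E(1)] invariant[OF E(3)]
      by (simp add: marked_polynomial_def mult_ac)
  qed
qed

end
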